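(* In the setting described in the context (in particular, the map $F(h)=mh+b$ of the original discontinuous equation has a fixed point $h_*>0$), consider the smoothed equations $$\dot x(t)=-\mu x(t)+\tilde a(t)\tilde f(x(t-1)).\qquad(\tilde a,\tilde f)$$ If $\delta>0$ (and $\rho>0$) is small enough, there exists a unique periodic solution $\tilde p$ with period $T=p_1+p_2$ and initial state $\tilde p_0=\tilde\varphi$, where $\tilde\varphi(0)=\tilde h$ is the unique fixed point (close to $h_*$) of the associated one-dimensional map $\tilde F$. The corresponding period map $P=P(T,0)$, with $P(\tilde\varphi)=\tilde\varphi$, maps a neighborhood of $\tilde\varphi$ in $C^0$ into a one-dimensional ($C^1$-)submanifold of $C^0$. For its derivative $M=DP(\tilde\varphi)$, there is an $M$-invariant decomposition $$C^0=\mathcal N\oplus\mathcal T$$ corresponding to the eigenvalues $0$ and $\lambda$ of $M$ (i.e. $\mathcal N=\ker M$, and $\mathcal T$ is one-dimensional with $Mv=\lambda v$ for $v\in\mathcal T$), where $\lambda=\tilde F'(\tilde h)$. Further, $\lambda\to m$ as $\delta\to0$, so, in particular, the periodic solution $\tilde p$ is stable for equation $(\tilde a,\tilde f)$ if $m<1$ and $\delta$ is small enough.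
   Context: Setting. $\mu,a_1,a_2,p_1,p_2>0$, $T=p_1+p_2$. For $h>0$ put $t_1(h)=\frac1\mu\ln\frac{\mu h+a_1}{a_1}$ and $t_2(h)=t_1(h)+1+\frac1\mu\ln(2-e^{-\mu})$. Let $$m=\Big[2\tfrac{a_2}{a_1}-e^{-\mu}\Big](2-e^{-\mu})e^{-\mu(T-2)},\quad b=\tfrac{2a_2-a_1e^{-\mu}}{\mu}(2-e^{-\mu})e^{-\mu(T-2)}+\tfrac{a_1-a_2}{\mu}e^{-\mu p_2}-\tfrac{a_2}{\mu},$$ and $F(h)=mh+b$. Standing assumption: $m\notin\{0,1\}$, $h_*>0$ is the fixed point of $F$, and at $h=h_*$ one has $0<t_1<t_1+1<t_2<p_1<t_2+1<T$. ($F$ is the map $h=x(0)\mapsto x(T)$ for the discontinuous equation $\dot x(t)=-\mu x(t)-a(t)\operatorname{sign}(x(t-1))$, $a$ being $T$-periodic with $a=a_1$ on $[0,p_1)$, $a=a_2$ on $[p_1,T)$, for positive initial functions and $h$ near $h_*$.) Smoothed data (for $\delta,\rho>0$). $\tilde f:\mathbb R\to\mathbb R$ is $C^\infty$, $\tilde f(x)=-\operatorname{sign}(x)$ for $|x|\ge\delta$, $-1\le\tilde f(x)\le1$ for $|x|\le\delta$, and, with $\alpha=-a_1/\mu$, $\int_{-\delta}^{\delta}\frac{\tilde f(u)}{(\alpha-u)^2}du=\int_{-\delta}^{\delta}\frac{-\operatorname{sign}(u)}{(\alpha-u)^2}du$. The function $\tilde a:\mathbb R\to\mathbb R$ is $C^\infty$,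 $T$-periodic, $\tilde a=a_1$ on $[\rho,p_1]$, $\tilde a=a_2$ on $[p_1+\rho,T]$, $0<\tilde a\le2\max\{a_1,a_2\}$ on $[0,\rho]\cup[p_1,p_1+\rho]$, and $\int_0^\rho\tilde a(s)e^{\mu s}ds=a_1\int_0^\rho e^{\mu s}ds$, $\int_{p_1}^{p_1+\rho}\tilde a(s)e^{\mu s}ds=a_2\int_{p_1}^{p_1+\rho}e^{\mu s}ds$. Maps. $C^0=C^0([-1,0],\mathbb R)$ with the maximum norm. For $\varphi\in C^0$ let $x^\varphi$ be the solution of $(\tilde a,\tilde f)$ for $t\ge0$ with $x^\varphi|_{[-1,0]}=\varphi$; write $x_t(s)=x(t+s)$, $s\in[-1,0]$. The period map is $P=P(T,0):C^0\to C^0$, $P(\varphi)=(x^\varphi)_T$, which is of class $C^1$. For $h$ near $h_*$, $\tilde F(h)=x^\varphi(T)$ for any $\varphi\in C^0$ with $\varphi\ge\delta$ on $[-1,0]$ and $\varphi(0)=h$ (this value depends only on $h$). Uniqueness is local: "unique fixed point close to $h_*$" means the only fixed point of $\tilde F$ in a neighborhood of $h_*$ independent of small $\delta,\rho$, and $\tilde p$ is the unique $T$-periodic solution with $\tilde p\ge\delta$ on $[-1,0]$ and $\tilde p(0)$ in that neighborhood. Stability is Lyapunov stability with respect to initial states in $C^0$ at time $0$. *)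

theory Defs
  imports "HOL-Analysis.Analysis"
begin

text \<open>
  The compact interval $[-1,0]$ as a metric space, so that the bounded continuous functions on it
  are exactly $C^0([-1,0],\mathbb R)$ with the maximum norm, and the library's Banach space
  structure applies.
\<close>

typedef lag = "{-1..0 :: real}"
  by (rule exI[of _ 0]) simp

instantiation lag :: metric_space
begin

definition dist_lag :: "lag \<Rightarrow> lag \<Rightarrow> real"
  where "dist_lag s t = dist (Rep_lag s) (Rep_lag t)"

definition uniformity_lag :: "(lag \<times> lag) filter"
  where "uniformity_lag = (INF e\<in>{0<..}. principal {(s, t). dist s t < e})"

definition open_lag :: "lag set \<Rightarrow> bool"
  where "open_lag U = (\<forall>s\<in>U. \<forall>\<^sub>F (s', t) in uniformity. s' = s \<longrightarrow> t \<in> U)"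

instance
  by standard
    (auto simp: uniformity_lag_def open_lag_def dist_lag_def Rep_lag_inject
       intro: dist_triangle2)

end

type_synonym C0 = "lag \<Rightarrow>\<^sub>C real"

lemma compact_UNIV_lag: "compact (UNIV :: lag set)"
proof -
  have "(UNIV :: lag set) = Abs_lag ` {-1..0}"
    by (auto simp: image_iff) (metis Rep_lag Rep_lag_inverse atLeastAtMost_iff)
  moreover have "continuous_on {-1..0} Abs_lag"
    by (auto simp: continuous_on_iff dist_lag_def Abs_lag_inverse)
  ultimately show ?thesis
    by (metis compact_Icc compact_continuous_image)
qed

lemma bcontfun_lag: "(bcontfun :: (lag \<Rightarrow> real) set) = {\<phi>. continuous_on UNIV \<phi>}"
  using compact_UNIV_lag
  by (auto simp: bcontfun_def intro!: compact_imp_bounded compact_continuous_image)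

definition segment :: "(real \<Rightarrow> real) \<Rightarrow> real \<Rightarrow> C0"
  where "segment x t = Bcontfun (\<lambda>s. x (t + Rep_lag s))"

lemma segment_apply:
  assumes "continuous_on {t-1..t} x"
  shows "apply_bcontfun (segment x t) s = x (t + Rep_lag s)"
proof -
  have R: "continuous_on UNIV Rep_lag"
    by (auto simp: continuous_on_iff dist_lag_def)
  have "continuous_on UNIV (\<lambda>s. x (t + Rep_lag s))"
    by (rule continuous_on_compose2[OF assms])
      (use Rep_lag in \<open>auto intro!: continuous_intros R\<close>)
  then show ?thesis
    by (simp add: segment_def bcontfun_lag Bcontfun_inverse)
qed

definition dde_solution ::
  "real \<Rightarrow> (real \<Rightarrow> real) \<Rightarrow> (real \<Rightarrow> real) \<Rightarrow> C0 \<Rightarrow> (real \<Rightarrow> real) \<Rightarrow> bool"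
  where "dde_solution \<mu> a f \<phi> x \<longleftrightarrow>
    continuous_on {-1..} x \<and>
    (\<forall>s. x (Rep_lag s) = apply_bcontfun \<phi> s) \<and>
    (\<forall>t\<ge>0. (x has_real_derivative (- \<mu> * x t + a t * f (x (t - 1)))) (at t within {0..}))"

text \<open>
  For continuous $a$, $f$ the method of steps gives a solution for every initial state, and it is
  unique on $[-1,\infty)$. Its values below $-1$ are arbitrary and never used.
\<close>

definition dde_sol ::
  "real \<Rightarrow> (real \<Rightarrow> real) \<Rightarrow> (real \<Rightarrow> real) \<Rightarrow> C0 \<Rightarrow> real \<Rightarrow> real"
  where "dde_sol \<mu> a f \<phi> = (SOME x. dde_solution \<mu> a f \<phi> x)"

definition period_map ::
  "real \<Rightarrow> (real \<Rightarrow> real) \<Rightarrow> (real \<Rightarrow> real) \<Rightarrow> real \<Rightarrow> C0 \<Rightarrow> C0"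
  where "period_map \<mu> a f T \<phi> = segment (dde_sol \<mu> a f \<phi>) T"

text \<open>
  When $f = -1$ on $[\delta,\infty)$, the value $x^\varphi(T)$ is the same for all
  $\varphi \ge \delta$ with $\varphi(0) = h$, so the description below is proper for
  every $h \ge \delta$.
\<close>

definition scalar_map ::
  "real \<Rightarrow> (real \<Rightarrow> real) \<Rightarrow> (real \<Rightarrow> real) \<Rightarrow> real \<Rightarrow> real \<Rightarrow> real \<Rightarrow> real"
  where "scalar_map \<mu> a f T \<delta> h =
    (THE y. \<exists>\<phi> :: C0. (\<forall>s. \<delta> \<le> apply_bcontfun \<phi> s) \<and>
      apply_bcontfun \<phi> (Abs_lag 0) = h \<and> y = dde_sol \<mu> a f \<phi> T)"

definition periodic_solution ::
  "real \<Rightarrow> (real \<Rightarrow> real) \<Rightarrow> (real \<Rightarrow> real) \<Rightarrow> real \<Rightarrow> (real \<Rightarrow> real) \<Rightarrow> bool"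
  where "periodic_solution \<mu> a f T p \<longleftrightarrow>
    (\<forall>t. p (t + T) = p t) \<and>
    (\<forall>t. (p has_real_derivative (- \<mu> * p t + a t * f (p (t - 1)))) (at t))"

definition lyapunov_stable ::
  "real \<Rightarrow> (real \<Rightarrow> real) \<Rightarrow> (real \<Rightarrow> real) \<Rightarrow> (real \<Rightarrow> real) \<Rightarrow> bool"
  where "lyapunov_stable \<mu> a f p \<longleftrightarrow>
    (\<forall>\<epsilon>>0. \<exists>d>0. \<forall>\<phi>. dist \<phi> (segment p 0) < d \<longrightarrow>
      (\<forall>t\<ge>0. dist (segment (dde_sol \<mu> a f \<phi>) t) (segment p t) < \<epsilon>))"

definition t1 :: "real \<Rightarrow> real \<Rightarrow> real \<Rightarrow> real"
  where "t1 \<mu> a1 h = (1 / \<mu>) * ln ((\<mu> * h + a1) / a1)"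

definition t2 :: "real \<Rightarrow> real \<Rightarrow> real \<Rightarrow> real"
  where "t2 \<mu> a1 h = t1 \<mu> a1 h + 1 + (1 / \<mu>) * ln (2 - exp (- \<mu>))"

definition slope :: "real \<Rightarrow> real \<Rightarrow> real \<Rightarrow> real \<Rightarrow> real \<Rightarrow> real"
  where "slope \<mu> a1 a2 p1 p2 =
    (2 * (a2 / a1) - exp (- \<mu>)) * (2 - exp (- \<mu>)) * exp (- \<mu> * (p1 + p2 - 2))"

definition offset :: "real \<Rightarrow> real \<Rightarrow> real \<Rightarrow> real \<Rightarrow> real \<Rightarrow> real"
  where "offset \<mu> a1 a2 p1 p2 =
    (2 * a2 - a1 * exp (- \<mu>)) / \<mu> * (2 - exp (- \<mu>)) * exp (- \<mu> * (p1 + p2 - 2))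
    + (a1 - a2) / \<mu> * exp (- \<mu> * p2) - a2 / \<mu>"

definition Fmap :: "real \<Rightarrow> real \<Rightarrow> real \<Rightarrow> real \<Rightarrow> real \<Rightarrow> real \<Rightarrow> real"
  where "Fmap \<mu> a1 a2 p1 p2 h = slope \<mu> a1 a2 p1 p2 * h + offset \<mu> a1 a2 p1 p2"

definition C_infinity :: "(real \<Rightarrow> real) \<Rightarrow> bool"
  where "C_infinity g \<longleftrightarrow> (\<forall>n. (deriv ^^ n) g differentiable_on UNIV)"

definition smoothed_feedback :: "real \<Rightarrow> real \<Rightarrow> real \<Rightarrow> (real \<Rightarrow> real) \<Rightarrow> bool"
  where "smoothed_feedback \<mu> a1 \<delta> f \<longleftrightarrow>
    C_infinity f \<and>
    (\<forall>x. \<delta> \<le> \<bar>x\<bar> \<longrightarrow> f x = - sgn x) \<and>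
    (\<forall>x. \<bar>x\<bar> \<le> \<delta> \<longrightarrow> -1 \<le> f x \<and> f x \<le> 1) \<and>
    (let \<alpha> = - a1 / \<mu> in
      integral {-\<delta>..\<delta>} (\<lambda>u. f u / (\<alpha> - u)\<^sup>2) = integral {-\<delta>..\<delta>} (\<lambda>u. - sgn u / (\<alpha> - u)\<^sup>2))"

definition smoothed_coefficient ::
  "real \<Rightarrow> real \<Rightarrow> real \<Rightarrow> real \<Rightarrow> real \<Rightarrow> real \<Rightarrow> (real \<Rightarrow> real) \<Rightarrow> bool"
  where "smoothed_coefficient \<mu> a1 a2 p1 p2 \<rho> a \<longleftrightarrow>
    C_infinity a \<and>
    (\<forall>t. a (t + (p1 + p2)) = a t) \<and>
    (\<forall>t\<in>{\<rho>..p1}. a t = a1) \<and>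
    (\<forall>t\<in>{p1+\<rho>..p1+p2}. a t = a2) \<and>
    (\<forall>t\<in>{0..\<rho>} \<union> {p1..p1+\<rho>}. 0 < a t \<and> a t \<le> 2 * max a1 a2) \<and>
    integral {0..\<rho>} (\<lambda>s. a s * exp (\<mu> * s)) = a1 * integral {0..\<rho>} (\<lambda>s. exp (\<mu> * s)) \<and>
    integral {p1..p1+\<rho>} (\<lambda>s. a s * exp (\<mu> * s)) = a2 * integral {p1..p1+\<rho>} (\<lambda>s. exp (\<mu> * s))"

definition C1_on :: "('a::real_normed_vector \<Rightarrow> 'b::real_normed_vector) \<Rightarrow> 'a set \<Rightarrow> bool"
  where "C1_on g U \<longleftrightarrow>
    (\<exists>g'. (\<forall>x\<in>U. (g has_derivative blinfun_apply (g' x)) (at x)) \<and> continuous_on U g')"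

text \<open>
  Locally a $C^1$-diffeomorphism between open subsets of the ambient space straightens the set to
  a line. A line always has a closed complement, so the usual splitting condition on the model
  subspace is automatic.
\<close>

definition one_dim_C1_submanifold :: "'a::real_normed_vector set \<Rightarrow> bool"
  where "one_dim_C1_submanifold S \<longleftrightarrow>
    (\<forall>q\<in>S. \<exists>U V (g :: 'a \<Rightarrow> 'a) k E.
      open U \<and> q \<in> U \<and> open V \<and> homeomorphism U V g k \<and> C1_on g U \<and> C1_on k V \<and>
      subspace E \<and> dim E = 1 \<and> g ` (S \<inter> U) = V \<inter> E)"

definition direct_sum :: "'a::real_vector set \<Rightarrow> 'a set \<Rightarrow> bool"
  where "direct_sum A B \<longleftrightarrow>
    subspace A \<and> subspace B \<and> A \<inter> B = {0} \<and> (\<forall>v. \<exists>x\<in>A. \<exists>y\<in>B. v = x + y)"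

end

theory Submission
  imports Defs
begin

text \<open>
  Multiplying a solution by \<open>exp (\<mu> t)\<close> turns the equation into an integral, so along an initial
  state \<open>\<ge> \<delta>\<close> with value \<open>h\<close> at \<open>0\<close> the solution is explicit as long as the delayed value stays
  outside the band \<open>[-\<delta>, \<delta>]\<close>. It crosses the band twice before time \<open>T - 1\<close>. Across the first
  crossing the smoothing condition on \<open>f\<close> makes the integral exactly that of \<open>-sgn\<close>; across the
  second one it differs by \<open>q (\<beta> - A h)\<close> with \<open>q = O(\<delta>)\<close> and \<open>A\<close> affine. Hence the scalar map is
  affine near \<open>h\<^sub>*\<close> with slope \<open>m + O(\<delta>)\<close>, which gives its fixed point and its derivative. Near the
  periodic state the period map is \<open>\<phi> \<mapsto> \<Gamma> (\<phi>(0))\<close> for a \<open>C\<^sup>1\<close> curve \<open>\<Gamma>\<close> in the state space, so its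
  derivative has rank one, and iterating it reduces stability to \<open>\<bar>slope\<bar> < 1\<close>.
\<close>

section \<open>Scalar delay equations\<close>

text \<open>The difference between the two crossings comes from the pole of the weight. On the way
  down a solution tends to \<open>- a1 / \<mu>\<close>, the \<alpha> of the smoothing condition, and
  that crossing is exact. On the way up it tends to \<open>a1 / \<mu>\<close>, where nothing is
  assumed and \<open>f\<close> may fail to be odd, so an error remains. This error is the same
  number for all \<open>h\<close> times the amplitude of the approach, and the amplitude is affine
  in \<open>h\<close>; so the scalar map stays affine instead of being merely close to
  \<open>Fmap\<close>. The moment conditions on \<open>a\<close> carry the weight
  \<open>exp (\<mu> * s)\<close> for a matching reason: outside the two transition windows the
  weighted primitive of \<open>a\<close> does not see the smoothing. The neighborhood of
  \<open>hs\<close> has to be fixed before \<delta>, \<rho>, \<open>f\<close> and \<open>a\<close>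
  are given. Margins are therefore measured on the discontinuous equation at \<open>hs\<close>; half
  of the least one is spent on \<delta>, half on moving \<open>h\<close>. For stability
  \<open>m < 1\<close> is enough because the inequalities between the times already force
  \<open>m > -1\<close>.\<close>

lemma unit_step_induct [consumes 1, case_names step]:
  fixes P :: "real \<Rightarrow> bool"
  assumes "0 \<le> t"
    and step: "\<And>t. 0 \<le> t \<Longrightarrow> (\<And>s. 0 \<le> s \<Longrightarrow> s \<le> t - 1 \<Longrightarrow> P s) \<Longrightarrow> P t"
  shows "P t"
proof -
  have "\<forall>t. 0 \<le> t \<and> t < real n \<longrightarrow> P t" for n
  proof (induction n)
    case (Suc n)
    show ?case
    proof (intro allI impI)
      fix t assume t: "0 \<le> t \<and> t < real (Suc n)"
      show "P t"
      proof (rule step)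
        fix s assume "0 \<le> s" "s \<le> t - 1"
        then show "P s" using Suc t by auto
      qed (use t in simp)
    qed
  qed auto
  then show ?thesis
    using \<open>0 \<le> t\<close> reals_Archimedean2 by blast
qed

lemma integral_has_derivative_atLeast:
  fixes g :: "real \<Rightarrow> real"
  assumes "continuous_on {c..} g" "c \<le> t"
  shows "((\<lambda>t. integral {c..t} g) has_real_derivative g t) (at t within {c..})"
proof -
  have "((\<lambda>t. integral {c..t} g) has_real_derivative g t) (at t within {c..t+1})"
    by (rule integral_has_real_derivative)
       (use assms in \<open>auto intro: continuous_on_subset\<close>)
  moreover have "at t within {c..t+1} = at t within {c..}"
    by (rule at_within_nhd[of t "{..<t+1}"]) auto
  ultimately show ?thesis by simp
qed

lemma continuous_on_integral_atLeast:
  fixes g :: "real \<Rightarrow> real"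
  assumes "continuous_on {c..} g"
  shows "continuous_on {c..} (\<lambda>t. integral {c..t} g)"
  by (rule DERIV_continuous_on[OF integral_has_derivative_atLeast[OF assms]]) auto

lemma Rep_lag_bounds: "-1 \<le> Rep_lag s" "Rep_lag s \<le> 0"
  using Rep_lag[of s] by auto

lemma Rep_lag_zero: "Rep_lag (Abs_lag 0) = 0"
  by (simp add: Abs_lag_inverse)

lemma segment_dist_le:
  assumes "continuous_on {t-1..t} x" "continuous_on {t-1..t} y"
    "\<And>s. s \<in> {t-1..t} \<Longrightarrow> \<bar>x s - y s\<bar> \<le> e"
  shows "dist (segment x t) (segment y t) \<le> e"
proof (rule dist_bound)
  fix s
  show "dist (segment x t s) (segment y t s) \<le> e"
    using assms(3)[of "t + Rep_lag s"] Rep_lag_bounds[of s]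
    by (simp add: segment_apply assms dist_real_def)
qed

text \<open>Constant continuation past both ends turns a state into a continuous function on the
  whole line, so that the method of steps can iterate on functions without tracking domains.\<close>

definition extend :: "C0 \<Rightarrow> real \<Rightarrow> real"
  where "extend \<phi> t = apply_bcontfun \<phi> (Abs_lag (max (-1) (min 0 t)))"

lemma continuous_extend: "continuous_on UNIV (extend \<phi>)"
proof -
  have *: "continuous_on {-1..0} Abs_lag"
    by (auto simp: continuous_on_iff dist_lag_def Abs_lag_inverse)
  have "continuous_on UNIV (\<lambda>t. Abs_lag (max (-1) (min 0 t)))"
    by (rule continuous_on_compose2[OF *]) (auto intro!: continuous_intros)
  then show ?thesis
    unfolding extend_def by (rule continuous_on_compose2[OF continuous_on_apply_bcontfun]) auto
qed

lemma extend_Rep: "extend \<phi> (Rep_lag s) = apply_bcontfun \<phi> s"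
  using Rep_lag_bounds[of s] by (simp add: extend_def Rep_lag_inverse)

lemma extend_nonneg: "0 \<le> t \<Longrightarrow> extend \<phi> t = apply_bcontfun \<phi> (Abs_lag 0)"
  by (simp add: extend_def)

locale scalar_dde =
  fixes \<mu> :: real and a f :: "real \<Rightarrow> real"
  assumes continuous_coefficient: "continuous_on UNIV a"
    and continuous_feedback: "continuous_on UNIV f"
begin

abbreviation solves :: "C0 \<Rightarrow> (real \<Rightarrow> real) \<Rightarrow> bool"
  where "solves \<equiv> dde_solution \<mu> a f"

text \<open>Along a solution this is the derivative of \<open>exp (\<mu> * s) * x s\<close>: the
  weight absorbs the damping term, and only the delayed value is left.\<close>

definition forcing :: "(real \<Rightarrow> real) \<Rightarrow> real \<Rightarrow> real"
  where "forcing x s = a s * exp (\<mu> * s) * f (x (s - 1))"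

lemma continuous_on_feedback [continuous_intros]:
  "continuous_on S g \<Longrightarrow> continuous_on S (\<lambda>s. f (g s))"
  using continuous_on_compose2[OF continuous_feedback] by auto

lemma continuous_on_coefficient [continuous_intros]:
  "continuous_on S g \<Longrightarrow> continuous_on S (\<lambda>s. a (g s))"
  using continuous_on_compose2[OF continuous_coefficient] by auto

lemma continuous_on_forcing:
  assumes "continuous_on S x" "\<And>s. s \<in> R \<Longrightarrow> s - 1 \<in> S"
  shows "continuous_on R (forcing x)"
proof -
  have "continuous_on R (\<lambda>s. x (s - 1))"
    by (rule continuous_on_compose2[OF assms(1)]) (use assms(2) in \<open>auto intro!: continuous_intros\<close>)
  then show ?thesis
    unfolding forcing_def by (intro continuous_intros)
qed

lemma solves_continuous: "solves \<phi> x \<Longrightarrow> continuous_on {-1..} x"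
  by (simp add: dde_solution_def)

lemma solves_initial: "solves \<phi> x \<Longrightarrow> s \<in> {-1..0} \<Longrightarrow> x s = apply_bcontfun \<phi> (Abs_lag s)"
  by (metis Abs_lag_inverse dde_solution_def)

lemma forcing_integrable:
  "solves \<phi> x \<Longrightarrow> 0 \<le> r \<Longrightarrow> forcing x integrable_on {r..t}"
  by (rule integrable_continuous_real, rule continuous_on_forcing[OF solves_continuous]) auto

lemma variation_of_constants:
  assumes x: "solves \<phi> x" and "0 \<le> r" "r \<le> t"
  shows "exp (\<mu> * t) * x t = exp (\<mu> * r) * x r + integral {r..t} (forcing x)"
proof -
  have "(forcing x has_integral exp (\<mu> * t) * x t - exp (\<mu> * r) * x r) {r..t}"
  proof (rule fundamental_theorem_of_calculus[OF \<open>r \<le> t\<close>])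
    fix s assume s: "s \<in> {r..t}"
    have "(x has_real_derivative (- \<mu> * x s + a s * f (x (s - 1)))) (at s within {0..})"
      using x s \<open>0 \<le> r\<close> by (auto simp: dde_solution_def)
    then have "(x has_real_derivative (- \<mu> * x s + a s * f (x (s - 1)))) (at s within {r..t})"
      by (rule DERIV_subset) (use \<open>0 \<le> r\<close> in auto)
    then have "((\<lambda>s. exp (\<mu> * s) * x s) has_real_derivative forcing x s) (at s within {r..t})"
      by (auto intro!: derivative_eq_intros simp: forcing_def algebra_simps)
    then show "((\<lambda>s. exp (\<mu> * s) * x s) has_vector_derivative forcing x s) (at s within {r..t})"
      by (simp add: has_real_derivative_iff_has_vector_derivative)
  qed
  then show ?thesis
    by (simp add: integral_unique)
qed

text \<open>Converse of \<open>variation_of_constants\<close>: for continuous \<open>x\<close> the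
  forcing is continuous, so the right-hand side of the integral equation is differentiable, and
  \<open>x\<close> inherits this from it.\<close>

lemma solvesI:
  assumes cont: "continuous_on {-1..} x"
    and init: "\<And>s. x (Rep_lag s) = apply_bcontfun \<phi> s"
    and eq: "\<And>t. 0 \<le> t \<Longrightarrow> x t = exp (- \<mu> * t) * (x 0 + integral {0..t} (forcing x))"
  shows "solves \<phi> x"
  unfolding dde_solution_def
proof (intro conjI allI impI)
  fix t :: real assume t: "0 \<le> t"
  have F: "continuous_on {0..} (forcing x)"
    by (rule continuous_on_forcing[OF cont]) auto
  have "((\<lambda>t. exp (- \<mu> * t) * (x 0 + integral {0..t} (forcing x))) has_real_derivative
      - \<mu> * exp (- \<mu> * t) * (x 0 + integral {0..t} (forcing x)) + exp (- \<mu> * t) * forcing x t)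
      (at t within {0..})"
    by (auto intro!: derivative_eq_intros integral_has_derivative_atLeast[OF F] t)
  moreover have "- \<mu> * exp (- \<mu> * t) * (x 0 + integral {0..t} (forcing x)) + exp (- \<mu> * t) * forcing x t
      = - \<mu> * x t + a t * f (x (t - 1))"
    using eq[OF t] by (simp add: forcing_def exp_minus)
  ultimately have "((\<lambda>t. exp (- \<mu> * t) * (x 0 + integral {0..t} (forcing x))) has_real_derivative
      - \<mu> * x t + a t * f (x (t - 1))) (at t within {0..})"
    by metis
  then show "(x has_real_derivative - \<mu> * x t + a t * f (x (t - 1))) (at t within {0..})"
    by (rule has_field_derivative_transform_within[OF _ zero_less_one])
       (use t in simp, rule eq[symmetric], simp)
qed (use assms in auto)

text \<open>The right-hand side of the integral equation. Clamping time at 0 makes it return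
  \<open>extend \<phi> t\<close> at negative times; at positive times \<open>extend \<phi> t\<close>
  is the initial value.\<close>

definition voc_step :: "C0 \<Rightarrow> (real \<Rightarrow> real) \<Rightarrow> real \<Rightarrow> real"
  where "voc_step \<phi> g t = exp (- \<mu> * max 0 t) * (extend \<phi> t + integral {0..max 0 t} (forcing g))"

lemma continuous_voc_step:
  assumes "continuous_on UNIV g"
  shows "continuous_on UNIV (voc_step \<phi> g)"
proof -
  have F: "continuous_on {0..} (forcing g)"
    by (rule continuous_on_forcing[OF assms]) auto
  have "continuous_on UNIV (\<lambda>t. integral {0..max 0 t} (forcing g))"
    by (rule continuous_on_compose2[OF continuous_on_integral_atLeast[OF F]])
       (auto intro!: continuous_intros)
  then show ?thesis
    unfolding voc_step_def by (intro continuous_intros continuous_extend)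
qed

definition iterate :: "C0 \<Rightarrow> nat \<Rightarrow> real \<Rightarrow> real"
  where "iterate \<phi> n = (voc_step \<phi> ^^ n) (extend \<phi>)"

lemma continuous_iterate: "continuous_on UNIV (iterate \<phi> n)"
  by (induction n) (simp_all add: iterate_def continuous_extend continuous_voc_step)

lemma iterate_Suc: "iterate \<phi> (Suc n) = voc_step \<phi> (iterate \<phi> n)"
  by (simp add: iterate_def)

text \<open>The forcing up to time \<open>t\<close> reads its argument only up to
  \<open>t - 1\<close>, so each application of \<open>voc_step\<close> settles one more unit
  interval for good.\<close>

lemma iterate_Suc_eq: "t \<le> real n \<Longrightarrow> iterate \<phi> (Suc n) t = iterate \<phi> n t"
proof (induction n arbitrary: t)
  case 0
  then show ?case by (simp add: iterate_def voc_step_def)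
next
  case (Suc n)
  have "integral {0..max 0 t} (forcing (iterate \<phi> (Suc n)))
      = integral {0..max 0 t} (forcing (iterate \<phi> n))"
    by (rule integral_cong) (use Suc in \<open>auto simp: forcing_def\<close>)
  then show ?case
    unfolding iterate_Suc[of \<phi> "Suc n"] iterate_Suc[of \<phi> n] voc_step_def iterate_Suc by simp
qed

lemma iterate_eq: "n \<le> m \<Longrightarrow> t \<le> real n \<Longrightarrow> iterate \<phi> m t = iterate \<phi> n t"
  by (induction m rule: dec_induct) (auto simp: iterate_Suc_eq)

lemma solution_exists: "\<exists>x. solves \<phi> x"
proof -
  \<comment> \<open>At time \<open>t\<close> the iterate number \<open>nat \<lceil>t\<rceil>\<close>
    is already settled, so \<open>x\<close> agrees with every later iterate there.\<close>
  define x where "x t = iterate \<phi> (nat \<lceil>t\<rceil>) t" for t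
  have x: "x t = iterate \<phi> n t" if "t \<le> real n" for t n
  proof -
    have "nat \<lceil>t\<rceil> \<le> n" "t \<le> real (nat \<lceil>t\<rceil>)"
      using that by linarith+
    then show ?thesis
      unfolding x_def by (metis iterate_eq)
  qed
  have cont: "continuous_on UNIV x"
  proof (rule continuous_at_imp_continuous_on, rule ballI)
    fix t :: real
    obtain n where n: "t < real n" using reals_Archimedean2 by blast
    have "isCont (iterate \<phi> n) t"
      using continuous_iterate[of \<phi> n] by (simp add: continuous_on_eq_continuous_at)
    moreover have "eventually (\<lambda>s. iterate \<phi> n s = x s) (nhds t)"
      using eventually_nhds_in_open[of "{..<real n}" t] n
      by (auto elim!: eventually_mono simp: x[of _ n])
    ultimately show "isCont x t"
      using isCont_cong by blast
  qed
  have nonpos: "x t = extend \<phi> t" if "t \<le> 0" for t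
    using x[of t 0] that by (simp add: iterate_def)
  show ?thesis
  proof (intro exI solvesI)
    show "continuous_on {-1..} x"
      using cont continuous_on_subset by blast
    show "x (Rep_lag s) = apply_bcontfun \<phi> s" for s
      using nonpos[of "Rep_lag s"] Rep_lag_bounds[of s] by (simp add: extend_Rep)
    fix t :: real assume t: "0 \<le> t"
    obtain n where n: "t < real n" using reals_Archimedean2 by blast
    have "x t = iterate \<phi> (Suc n) t"
      using n by (intro x) auto
    also have "\<dots> = exp (- \<mu> * t) * (extend \<phi> t + integral {0..t} (forcing (iterate \<phi> n)))"
      using t by (simp add: iterate_Suc voc_step_def)
    also have "integral {0..t} (forcing (iterate \<phi> n)) = integral {0..t} (forcing x)"
      by (rule integral_cong) (use n in \<open>auto simp: forcing_def x[of _ n]\<close>)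
    also have "extend \<phi> t = x 0"
      using t by (simp add: nonpos extend_nonneg)
    finally show "x t = exp (- \<mu> * t) * (x 0 + integral {0..t} (forcing x))" .
  qed
qed

lemma dde_sol_solves: "solves \<phi> (dde_sol \<mu> a f \<phi>)"
  unfolding dde_sol_def using solution_exists by (rule someI_ex)

text \<open>A history acts on the future only through its values under \<open>f\<close>, so equality
  of these and of the current value suffices. Where \<open>f\<close> is constant, different
  histories merge in this way; uniqueness, periodicity and the comparison after \<open>n\<close>
  periods all rest on it. Shifting time by a period multiplies the forcing by
  \<open>exp (\<mu> * r)\<close>, which cancels.\<close>

lemma solution_shift:
  assumes x: "solves \<phi> x" and y: "solves \<psi> y" and "0 \<le> r" and period: "\<And>t. a (t + r) = a t"
    and start: "x r = y 0" and history: "\<And>s. s \<in> {-1..0} \<Longrightarrow> f (x (r + s)) = f (y s)"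
    and "0 \<le> t"
  shows "x (r + t) = y t"
  using \<open>0 \<le> t\<close>
proof (induction t rule: unit_step_induct)
  case (step t)
  have "exp (\<mu> * (r + t)) * x (r + t) = exp (\<mu> * r) * x r + integral {r..r+t} (forcing x)"
    using variation_of_constants[OF x \<open>0 \<le> r\<close>, of "r + t"] step by simp
  also have "integral {r..r+t} (forcing x) = integral {0..t} (\<lambda>s. forcing x (r + s))"
    using integral_shift_Icc_real[of 0 t "forcing x" r] by (simp add: o_def add.commute)
  also have "\<dots> = integral {0..t} (\<lambda>s. exp (\<mu> * r) * forcing y s)"
  proof (rule integral_cong)
    fix s assume s: "s \<in> {0..t}"
    have "f (x (r + s - 1)) = f (y (s - 1))"
    proof (cases "s \<le> 1")
      case True
      then show ?thesis using history[of "s - 1"] s by (simp add: algebra_simps)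
    next
      case False
      then have "x (r + (s - 1)) = y (s - 1)" using step(2)[of "s - 1"] s by auto
      then show ?thesis by (simp add: algebra_simps)
    qed
    then show "forcing x (r + s) = exp (\<mu> * r) * forcing y s"
      using period[of s] by (simp add: forcing_def exp_add distrib_left add.commute)
  qed
  also have "\<dots> = exp (\<mu> * r) * integral {0..t} (forcing y)"
    by simp
  also have "exp (\<mu> * r) * x r + exp (\<mu> * r) * integral {0..t} (forcing y) = exp (\<mu> * r) * (exp (\<mu> * t) * y t)"
    using variation_of_constants[OF y, of 0 t] step start by (simp add: algebra_simps)
  finally show ?case
    by (simp add: exp_add algebra_simps)
qed

lemma solution_unique:
  assumes "solves \<phi> x" "solves \<phi> y" "-1 \<le> t"
  shows "x t = y t"
proof (cases "0 \<le> t")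
  case True
  then show ?thesis
    using solution_shift[OF assms(1,2), of 0 t] solves_initial[OF assms(1)] solves_initial[OF assms(2)]
    by simp
next
  case False
  then show ?thesis
    using assms solves_initial[OF assms(1)] solves_initial[OF assms(2)] by simp
qed

lemma lipschitz_dependence:
  assumes lip: "\<And>u v. \<bar>f u - f v\<bar> \<le> K * \<bar>u - v\<bar>" and \<mu>: "0 \<le> \<mu>"
  shows "\<exists>C\<ge>0. \<forall>\<phi> \<psi> x y t. solves \<phi> x \<longrightarrow> solves \<psi> y \<longrightarrow> t \<in> {-1..real n} \<longrightarrow>
    \<bar>x t - y t\<bar> \<le> C * dist \<phi> \<psi>"
proof (induction n)
  case 0
  show ?case
  proof (rule exI[of _ 1], intro conjI allI impI)
    fix \<phi> \<psi> x y and t :: real assume *: "solves \<phi> x" "solves \<psi> y" "t \<in> {-1..real 0}"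
    then show "\<bar>x t - y t\<bar> \<le> 1 * dist \<phi> \<psi>"
      using solves_initial[OF *(1), of t] solves_initial[OF *(2), of t] 
        dist_bounded[of \<phi> "Abs_lag t" \<psi>]
      by (simp add: dist_real_def)
  qed simp
next
  case (Suc n)
  then obtain C where C: "C \<ge> 0" "\<And>\<phi> \<psi> x y t. solves \<phi> x \<Longrightarrow> solves \<psi> y \<Longrightarrow> t \<in> {-1..real n} \<Longrightarrow>
    \<bar>x t - y t\<bar> \<le> C * dist \<phi> \<psi>" by blast
  have "bounded ((\<lambda>s. a s * exp (\<mu> * s)) ` {0..real (Suc n)})"
    by (intro compact_imp_bounded compact_continuous_image continuous_intros) auto
  then obtain A where A: "A > 0" "\<And>s. s \<in> {0..real (Suc n)} \<Longrightarrow> \<bar>a s * exp (\<mu> * s)\<bar> \<le> A"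
    by (auto simp: bounded_pos)
  have K: "K \<ge> 0" using lip[of 0 1] by simp
  define L where "L = 1 + C + A * K * C * real (Suc n)"
  have AKC: "0 \<le> A * K * C" using A C K by simp
  have L: "L \<ge> 0" using A C K by (simp add: L_def)
  have "\<bar>x t - y t\<bar> \<le> L * dist \<phi> \<psi>"
    if x: "solves \<phi> x" and y: "solves \<psi> y" and t: "t \<in> {-1..real (Suc n)}" for \<phi> \<psi> x y t
  proof (cases "t \<le> 0")
    case True
    then have "\<bar>x t - y t\<bar> \<le> C * dist \<phi> \<psi>"
      using C(2)[OF x y] t by auto
    also have "\<dots> \<le> L * dist \<phi> \<psi>"
      using AKC by (intro mult_right_mono) (auto simp: L_def)
    finally show ?thesis .
  next
    case False
    have int: "forcing x integrable_on {0..t}" "forcing y integrable_on {0..t}"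
      using forcing_integrable x y by auto
    have "exp (\<mu> * t) * (x t - y t) = (x 0 - y 0) + (integral {0..t} (forcing x) - integral {0..t} (forcing y))"
      using variation_of_constants[OF x, of 0 t] variation_of_constants[OF y, of 0 t] False
      by (simp add: algebra_simps)
    also have "integral {0..t} (forcing x) - integral {0..t} (forcing y)
        = integral {0..t} (\<lambda>s. forcing x s - forcing y s)"
      using int by (simp add: integral_diff)
    finally have eq: "exp (\<mu> * t) * (x t - y t) = x 0 - y 0 + integral {0..t} (\<lambda>s. forcing x s - forcing y s)" .
    have "norm (integral {0..t} (\<lambda>s. forcing x s - forcing y s)) \<le> A * K * C * dist \<phi> \<psi> * (t - 0)"
    proof (rule integral_bound)
      show "continuous_on {0..t} (\<lambda>s. forcing x s - forcing y s)"
        by (intro continuous_on_diff continuous_on_forcing[OF solves_continuous[OF x]]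
            continuous_on_forcing[OF solves_continuous[OF y]]) auto
      fix s assume s: "s \<in> {0..t}"
      have "\<bar>f (x (s - 1)) - f (y (s - 1))\<bar> \<le> K * \<bar>x (s - 1) - y (s - 1)\<bar>"
        by (rule lip)
      also have "\<dots> \<le> K * (C * dist \<phi> \<psi>)"
        using C(2)[OF x y, of "s - 1"] s t K by (intro mult_left_mono) auto
      finally have *: "\<bar>f (x (s - 1)) - f (y (s - 1))\<bar> \<le> K * (C * dist \<phi> \<psi>)" .
      have "norm (forcing x s - forcing y s) = \<bar>a s * exp (\<mu> * s)\<bar> * \<bar>f (x (s - 1)) - f (y (s - 1))\<bar>"
        by (simp add: forcing_def abs_mult[symmetric] algebra_simps)
      also have "\<dots> \<le> A * (K * (C * dist \<phi> \<psi>))"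
        using A s t * by (intro mult_mono) auto
      finally show "norm (forcing x s - forcing y s) \<le> A * K * C * dist \<phi> \<psi>"
        by (simp add: mult.assoc)
    qed (use False in auto)
    also have "\<dots> \<le> A * K * C * dist \<phi> \<psi> * real (Suc n)"
      using t AKC by (intro mult_left_mono) auto
    finally have I: "norm (integral {0..t} (\<lambda>s. forcing x s - forcing y s)) \<le> A * K * C * dist \<phi> \<psi> * real (Suc n)" .
    have Z: "\<bar>x 0 - y 0\<bar> \<le> C * dist \<phi> \<psi>"
      using C(2)[OF x y] by auto
    have "1 \<le> exp (\<mu> * t)" using \<mu> False by simp
    then have "\<bar>x t - y t\<bar> \<le> exp (\<mu> * t) * \<bar>x t - y t\<bar>"
      by (simp add: mult_le_cancel_right1)
    also have "\<dots> = \<bar>exp (\<mu> * t) * (x t - y t)\<bar>" by (simp add: abs_mult)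
    also have "\<dots> \<le> C * dist \<phi> \<psi> + A * K * C * dist \<phi> \<psi> * real (Suc n)"
      unfolding eq using I Z by simp
    also have "\<dots> \<le> L * dist \<phi> \<psi>"
      by (simp add: L_def algebra_simps)
    finally show ?thesis .
  qed
  then show ?case using L by blast
qed

end

section \<open>Curves in the state space\<close>

text \<open>The derivative is the identity plus the rank-one operator
  \<open>w \<mapsto> e w *\<^sub>R G' (e q)\<close>, which depends linearly and boundedly on the
  vector \<open>G' (e q)\<close>; this gives continuity in operator norm. A straightening map and
  its inverse are both of this form.\<close>

lemma C1_on_shear:
  fixes e :: "'a::real_normed_vector \<Rightarrow> real" and G G' :: "real \<Rightarrow> 'a"
  assumes e: "bounded_linear e"
    and der: "\<And>v. (G has_vector_derivative G' v) (at v)" and cont: "continuous_on UNIV G'"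
  shows "C1_on (\<lambda>q. q + G (e q)) U"
  unfolding C1_on_def
proof (intro exI conjI ballI)
  let ?D = "\<lambda>q. id_blinfun + (blinfun_scaleR_left (G' (e q)) o\<^sub>L Blinfun e)"
  interpret bounded_linear e by (rule e)
  fix q
  have "(e has_derivative e) (at q)"
    by (rule bounded_linear_imp_has_derivative[OF e])
  then have "((\<lambda>q. G (e q)) has_derivative (\<lambda>w. e w *\<^sub>R G' (e q))) (at q)"
    using has_derivative_compose[of e e q UNIV G "\<lambda>x. x *\<^sub>R G' (e q)"] der[of "e q"]
    by (simp add: has_vector_derivative_def)
  then have "((\<lambda>q. q + G (e q)) has_derivative (\<lambda>w. w + e w *\<^sub>R G' (e q))) (at q)"
    by (intro derivative_intros)
  then show "((\<lambda>q. q + G (e q)) has_derivative blinfun_apply (?D q)) (at q)"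
    by (simp add: plus_blinfun.rep_eq bounded_linear_Blinfun_apply[OF e])
next
  have "continuous_on U (\<lambda>q. G' (e q))"
    by (rule continuous_on_compose2[OF cont])
       (auto intro: linear_continuous_on e)
  then show "continuous_on U (\<lambda>q. id_blinfun + (blinfun_scaleR_left (G' (e q)) o\<^sub>L Blinfun e))"
    by (intro continuous_intros bounded_linear.continuous_on[OF bounded_linear_blinfun_scaleR_left]
        bounded_linear.continuous_on[OF bounded_bilinear.bounded_linear_left[OF bounded_bilinear_blinfun_compose]])
qed

text \<open>
  Since \<open>e\<close> is an affine coordinate along the curve, the curve is a graph over the line spanned
  by \<open>u\<close>, and subtracting the graph straightens it.
\<close>

lemma curve_one_dim_C1_submanifold:
  fixes e :: "'a::real_normed_vector \<Rightarrow> real" and \<Gamma> \<Gamma>' :: "real \<Rightarrow> 'a"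
  assumes e: "bounded_linear e" and u: "e u = 1" and I: "open I"
    and der: "\<And>h. (\<Gamma> has_vector_derivative \<Gamma>' h) (at h)" and cont: "continuous_on UNIV \<Gamma>'"
    and m: "m \<noteq> 0" and coord: "\<And>h. h \<in> I \<Longrightarrow> e (\<Gamma> h) = m * h + c"
  shows "one_dim_C1_submanifold (\<Gamma> ` I)"
proof -
  interpret bounded_linear e by (rule e)
  \<comment> \<open>\<open>(v - c) / m\<close> is the parameter at which the curve has coordinate
    \<open>v\<close>, so \<open>H v\<close> is the offset of the curve from the line.\<close>
  define H where "H v = \<Gamma> ((v - c) / m) - v *\<^sub>R u" for v
  define H' where "H' v = (1 / m) *\<^sub>R \<Gamma>' ((v - c) / m) - u" for v
  have H: "(H has_vector_derivative H' v) (at v)" for v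
  proof -
    have "((\<lambda>v. (v - c) / m) has_vector_derivative 1 / m) (at v)"
      using m by (auto intro!: derivative_eq_intros simp flip: has_real_derivative_iff_has_vector_derivative)
    then have "((\<Gamma> \<circ> (\<lambda>v. (v - c) / m)) has_vector_derivative (1 / m) *\<^sub>R \<Gamma>' ((v - c) / m)) (at v)"
      by (rule vector_diff_chain_at) (rule der)
    then show ?thesis
      unfolding H_def H'_def o_def by (auto intro!: derivative_eq_intros)
  qed
  have contH': "continuous_on UNIV H'"
    unfolding H'_def using m
    by (intro continuous_intros continuous_on_compose2[OF cont]) auto
  have negH: "((\<lambda>v. - H v) has_vector_derivative - H' v) (at v)" for v
    by (intro derivative_intros H)
  define U where "U = {q. (e q - c) / m \<in> I}"
  define g where "g q = q - H (e q)" for q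
  define k where "k r = r + H (e r)" for r
  \<comment> \<open>As the offset lies in the kernel of \<open>e\<close>, the two shears preserve
    the coordinate, map \<open>U\<close> to itself and undo each other.\<close>
  have eH: "e (H v) = 0" if "(v - c) / m \<in> I" for v
    using coord[OF that] m u by (simp add: H_def diff scaleR)
  have contH: "continuous_on UNIV H"
    by (rule continuous_at_imp_continuous_on) (use H has_vector_derivative_continuous in blast)
  have conte: "continuous_on S e" for S
    by (rule linear_continuous_on[OF e])
  have "open ((\<lambda>q. (e q - c) / m) -` I)"
    using m by (intro open_vimage I continuous_intros conte) auto
  then have "open U"
    by (simp add: U_def vimage_def)
  moreover have "homeomorphism U U g k"
  proof
    show "continuous_on U g" "continuous_on U k"
      unfolding g_def k_def
      by (intro continuous_intros continuous_on_compose2[OF contH] conte; simp)+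
  qed (auto simp: U_def g_def k_def diff add eH)
  moreover have "C1_on g U" "C1_on k U"
    using C1_on_shear[OF e negH, of U] C1_on_shear[OF e H contH', of U] contH'
    by (auto simp: g_def k_def[abs_def] g_def[abs_def] intro: continuous_intros)
  moreover have "\<Gamma> ` I \<subseteq> U"
    using coord m by (auto simp: U_def)
  moreover have "g ` (\<Gamma> ` I \<inter> U) = U \<inter> span {u}"
  proof (intro equalityI subsetI)
    fix r assume "r \<in> g ` (\<Gamma> ` I \<inter> U)"
    then obtain h where h: "h \<in> I" "r = g (\<Gamma> h)" by auto
    then have "r = (m * h + c) *\<^sub>R u"
      using m by (simp add: g_def H_def coord)
    then show "r \<in> U \<inter> span {u}"
      using h m by (simp add: U_def scaleR u span_base span_scale)
  next
    fix r assume r: "r \<in> U \<inter> span {u}"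
    then obtain d where d: "r = d *\<^sub>R u" by (auto simp: span_singleton)
    then have h: "(d - c) / m \<in> I" using r by (simp add: U_def scaleR u)
    have "r = g (\<Gamma> ((d - c) / m))"
      using m by (simp add: g_def H_def coord[OF h] d)
    then show "r \<in> g ` (\<Gamma> ` I \<inter> U)"
      using h \<open>\<Gamma> ` I \<subseteq> U\<close> by blast
  qed
  moreover have "dim (span {u}) = 1"
    by (subst dim_span_eq_card_independent) (use u zero in \<open>auto simp: dependent_single\<close>)
  ultimately show ?thesis
    unfolding one_dim_C1_submanifold_def by (metis subset_iff IntD1 subspace_span)
qed

text \<open>The chain rule gives the derivative \<open>x \<mapsto> e x *\<^sub>R v\<close>. Its
  kernel is that of \<open>e\<close>, and \<open>v\<close> is an eigenvector for
  \<open>e v = lam\<close>; \<open>lam \<noteq> 0\<close> keeps \<open>v\<close> out of the kernel,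
  so the two spaces are complementary. The vector \<open>w\<close> witnesses that the kernel is not
  trivial.\<close>

lemma rank_one_derivative:
  fixes P :: "'a::real_normed_vector \<Rightarrow> 'a" and \<Gamma> :: "real \<Rightarrow> 'a"
  assumes e: "bounded_linear e" and U: "open U" "\<phi> \<in> U" and P: "\<And>\<psi>. \<psi> \<in> U \<Longrightarrow> P \<psi> = \<Gamma> (e \<psi>)"
    and der: "(\<Gamma> has_vector_derivative v) (at (e \<phi>))"
    and v: "e v = lam" "lam \<noteq> 0" and w: "w \<noteq> 0" "e w = 0"
  shows "\<exists>(M :: 'a \<Rightarrow>\<^sub>L 'a) N L.
    (P has_derivative blinfun_apply M) (at \<phi>) \<and> direct_sum N L \<and>
    blinfun_apply M ` N \<subseteq> N \<and> blinfun_apply M ` L \<subseteq> L \<and>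
    N = {v. blinfun_apply M v = 0} \<and> N \<noteq> {0} \<and>
    dim L = 1 \<and> (\<forall>v\<in>L. blinfun_apply M v = lam *\<^sub>R v)"
proof -
  interpret bounded_linear e by (rule e)
  define M where "M = blinfun_scaleR_left v o\<^sub>L Blinfun e"
  have M: "blinfun_apply M x = e x *\<^sub>R v" for x
    by (simp add: M_def bounded_linear_Blinfun_apply[OF e])
  have v0: "v \<noteq> 0" using v zero by auto
  have "((\<lambda>\<psi>. \<Gamma> (e \<psi>)) has_derivative (\<lambda>x. e x *\<^sub>R v)) (at \<phi>)"
    using has_derivative_compose[of e e \<phi> UNIV \<Gamma> "\<lambda>x. x *\<^sub>R v"] der bounded_linear_imp_has_derivative[OF e]
    by (simp add: has_vector_derivative_def)
  then have "(P has_derivative blinfun_apply M) (at \<phi>)"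
    unfolding M using has_derivative_transform_within_open[OF _ U] P by (metis (no_types, lifting))
  moreover define N where "N = {x. blinfun_apply M x = 0}"
  moreover have N: "N = {x. e x = 0}"
    using v0 by (simp add: N_def M)
  have "direct_sum N (span {v})"
    unfolding direct_sum_def
  proof (intro conjI allI)
    show "subspace N" unfolding N by (auto simp: subspace_def add scaleR)
    show "N \<inter> span {v} = {0}"
      using v by (auto simp: N span_singleton scaleR zero)
    fix x
    \<comment> \<open>This multiple of \<open>v\<close> has the same value under \<open>e\<close> as
      \<open>x\<close>.\<close>
    have "x - (e x / lam) *\<^sub>R v \<in> N" "(e x / lam) *\<^sub>R v \<in> span {v}"
      using v by (auto simp: N diff scaleR span_base span_scale)
    then show "\<exists>y\<in>N. \<exists>z\<in>span {v}. x = y + z"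
      by (metis diff_add_cancel)
  qed simp
  moreover have "blinfun_apply M ` N \<subseteq> N"
    by (auto simp: N M)
  moreover have "blinfun_apply M x = lam *\<^sub>R x" if "x \<in> span {v}" for x
    using that v by (auto simp: span_singleton M scaleR)
  moreover from this have "blinfun_apply M ` span {v} \<subseteq> span {v}"
    by (auto intro: span_scale)
  moreover have "N \<noteq> {0}" using w by (auto simp: N)
  moreover have "dim (span {v}) = 1"
    by (subst dim_span_eq_card_independent) (use v0 in \<open>auto simp: dependent_single\<close>)
  ultimately show ?thesis by blast
qed

lemma uniform_parametric_integral:
  fixes N :: "real \<Rightarrow> real \<Rightarrow> real"
  assumes cont: "continuous_on (UNIV \<times> {c..b}) (\<lambda>(h, s). N h s)" and "c \<le> b" "0 < \<epsilon>"
  shows "\<exists>d>0. \<forall>h. \<bar>h - h0\<bar> < d \<longrightarrow> (\<forall>t\<in>{c..b}. \<bar>integral {c..t} (N h) - integral {c..t} (N h0)\<bar> \<le> \<epsilon>)"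
proof -
  have slice: "continuous_on {c..t} (N h)" if "t \<in> {c..b}" for h t
  proof -
    have "continuous_on {c..t} (\<lambda>s. (h, s))" by (intro continuous_intros)
    then show ?thesis
      using continuous_on_compose2[OF cont, of "{c..t}" "\<lambda>s. (h, s)"] that
      by (simp add: image_subset_iff)
  qed
  have "uniformly_continuous_on ({h0-1..h0+1} \<times> {c..b}) (\<lambda>(h, s). N h s)"
    by (intro compact_uniformly_continuous compact_Times compact_Icc continuous_on_subset[OF cont]) auto
  \<comment> \<open>The added 1 keeps the denominator positive when \<open>b = c\<close>.\<close>
  moreover have "0 < \<epsilon> / (b - c + 1)" using assms by simp
  ultimately obtain d where d: "d > 0" "\<And>p q. p \<in> {h0-1..h0+1} \<times> {c..b} \<Longrightarrow> q \<in> {h0-1..h0+1} \<times> {c..b} \<Longrightarrow>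
      dist q p < d \<Longrightarrow> dist (case q of (h, s) \<Rightarrow> N h s) (case p of (h, s) \<Rightarrow> N h s) < \<epsilon> / (b - c + 1)"
    unfolding uniformly_continuous_on_def by meson
  show ?thesis
  proof (intro exI[of _ "min d 1"] conjI allI impI ballI)
    fix h t assume h: "\<bar>h - h0\<bar> < min d 1" and t: "t \<in> {c..b}"
    have "norm (integral {c..t} (\<lambda>s. N h s - N h0 s)) \<le> \<epsilon> / (b - c + 1) * (t - c)"
    proof (rule integral_bound)
      fix s assume "s \<in> {c..t}"
      then show "norm (N h s - N h0 s) \<le> \<epsilon> / (b - c + 1)"
        using d(2)[of "(h0, s)" "(h, s)"] h t by (auto simp: dist_Pair_Pair dist_real_def abs_less_iff)
    qed (use t in \<open>auto intro!: continuous_on_diff slice\<close>)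
    also have "\<dots> \<le> \<epsilon> / (b - c + 1) * (b - c + 1)"
      using t assms by (intro mult_left_mono) auto
    also have "\<dots> = \<epsilon>" using assms by simp
    finally show "\<bar>integral {c..t} (N h) - integral {c..t} (N h0)\<bar> \<le> \<epsilon>"
      using t by (subst (asm) integral_diff) (auto intro!: integrable_continuous_real slice)
  qed (use d in auto)
qed

text \<open>Derivatives at each fixed time become a derivative in the maximum norm because
  \<open>D\<close> varies continuously in \<open>h\<close> uniformly in \<open>t\<close>: the mean
  value inequality for \<open>h \<mapsto> y h t - h * D h0 t\<close> then gives one error bound for
  all \<open>t\<close>.\<close>

lemma segment_C1:
  fixes y D :: "real \<Rightarrow> real \<Rightarrow> real"
  assumes der: "\<And>h t. t \<in> {T-1..T} \<Longrightarrow> ((\<lambda>h. y h t) has_real_derivative D h t) (at h)"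
    and y: "\<And>h. continuous_on {T-1..T} (y h)" and D: "\<And>h. continuous_on {T-1..T} (D h)"
    and unif: "\<And>h0 \<epsilon>. 0 < \<epsilon> \<Longrightarrow> \<exists>d>0. \<forall>h. \<bar>h - h0\<bar> < d \<longrightarrow> (\<forall>t\<in>{T-1..T}. \<bar>D h t - D h0 t\<bar> \<le> \<epsilon>)"
  shows "((\<lambda>h. segment (y h) T) has_vector_derivative segment (D h0) T) (at h0)"
    and "continuous_on UNIV (\<lambda>h. segment (D h) T)"
proof -
  show "continuous_on UNIV (\<lambda>h. segment (D h) T)"
    unfolding continuous_on_iff
  proof (intro ballI allI impI)
    fix h1 \<epsilon> :: real assume \<epsilon>: "0 < \<epsilon>"
    obtain d where d: "d > 0" "\<And>h t. \<bar>h - h1\<bar> < d \<Longrightarrow> t \<in> {T-1..T} \<Longrightarrow> \<bar>D h t - D h1 t\<bar> \<le> \<epsilon> / 2"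
      using unif[of "\<epsilon> / 2" h1] \<epsilon> by (auto simp: dist_real_def)
    have "dist (segment (D h) T) (segment (D h1) T) < \<epsilon>" if "\<bar>h - h1\<bar> < d" for h
      using segment_dist_le[of T "D h" "D h1" "\<epsilon> / 2", OF D D d(2)[OF that]] \<epsilon> by simp
    then show "\<exists>d>0. \<forall>h\<in>UNIV. dist h h1 < d \<longrightarrow> dist (segment (D h) T) (segment (D h1) T) < \<epsilon>"
      using d(1) by (auto simp: dist_real_def)
  qed
  show "((\<lambda>h. segment (y h) T) has_vector_derivative segment (D h0) T) (at h0)"
    unfolding has_vector_derivative_def has_derivative_within_alt
  proof (intro conjI allI impI)
    show "bounded_linear (\<lambda>x. x *\<^sub>R segment (D h0) T)"
      by (rule bounded_linear_scaleR_left)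
    fix \<epsilon> :: real assume \<epsilon>: "0 < \<epsilon>"
    obtain d where d: "d > 0" "\<And>h t. \<bar>h - h0\<bar> < d \<Longrightarrow> t \<in> {T-1..T} \<Longrightarrow> \<bar>D h t - D h0 t\<bar> \<le> \<epsilon>"
      using unif[OF \<epsilon>, of h0] by auto
    have "norm (segment (y h) T - segment (y h0) T - (h - h0) *\<^sub>R segment (D h0) T) \<le> \<epsilon> * norm (h - h0)"
      if h: "\<bar>h - h0\<bar> < d" for h
    proof (rule norm_bound)
      fix s :: lag
      let ?t = "T + Rep_lag s"
      have t: "?t \<in> {T-1..T}" using Rep_lag_bounds[of s] by simp
      have "norm ((y h ?t - h * D h0 ?t) - (y h0 ?t - h0 * D h0 ?t)) \<le> \<epsilon> * norm (h - h0)"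
      proof (rule field_differentiable_bound[of "ball h0 d"])
        fix z assume z: "z \<in> ball h0 d"
        show "((\<lambda>h. y h ?t - h * D h0 ?t) has_field_derivative D z ?t - D h0 ?t) (at z within ball h0 d)"
          by (auto intro!: derivative_eq_intros DERIV_subset[OF der[OF t]])
        show "norm (D z ?t - D h0 ?t) \<le> \<epsilon>"
          using d(2)[OF _ t, of z] z by (simp add: dist_real_def abs_minus_commute)
      qed (use h d(1) in \<open>auto simp: dist_real_def abs_minus_commute\<close>)
      then show "norm ((segment (y h) T - segment (y h0) T - (h - h0) *\<^sub>R segment (D h0) T) s) \<le> \<epsilon> * norm (h - h0)"
        by (simp add: segment_apply y D algebra_simps)
    qed
    then show "\<exists>d>0. \<forall>h\<in>UNIV. norm (h - h0) < d \<longrightarrow>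
        norm (segment (y h) T - segment (y h0) T - (h - h0) *\<^sub>R segment (D h0) T) \<le> \<epsilon> * norm (h - h0)"
      using d(1) by auto
  qed
qed

section \<open>Passage through the band\<close>

text \<open>The failure of the smoothing condition when its pole is moved to \<open>\<beta>\<close>.
  This is the only trace of the shape of \<open>g\<close> that a crossing with asymptote
  \<open>\<beta>\<close> leaves.\<close>

definition feedback_defect :: "real \<Rightarrow> real \<Rightarrow> (real \<Rightarrow> real) \<Rightarrow> real"
  where "feedback_defect \<beta> \<delta> g =
    integral {-\<delta>..\<delta>} (\<lambda>u. g u / (\<beta> - u)\<^sup>2) - integral {-\<delta>..\<delta>} (\<lambda>u. - sgn u / (\<beta> - u)\<^sup>2)"

lemma has_integral_inverse_square:
  fixes \<beta> :: real
  assumes "l \<le> r" "r < \<beta>"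
  shows "((\<lambda>u. 1 / (\<beta> - u)\<^sup>2) has_integral (1 / (\<beta> - r) - 1 / (\<beta> - l))) {l..r}"
proof (rule fundamental_theorem_of_calculus[OF \<open>l \<le> r\<close>])
  fix u assume "u \<in> {l..r}"
  then have "\<beta> - u \<noteq> 0" using assms by auto
  then show "((\<lambda>u. 1 / (\<beta> - u)) has_vector_derivative 1 / (\<beta> - u)\<^sup>2) (at u within {l..r})"
    unfolding has_real_derivative_iff_has_vector_derivative[symmetric]
    by (auto intro!: derivative_eq_intros simp: power2_eq_square)
qed

lemma has_integral_sgn_inverse_square:
  fixes \<beta> :: real
  assumes "0 < \<delta>" "\<delta> < \<beta>"
  shows "((\<lambda>u. - sgn u / (\<beta> - u)\<^sup>2) has_integral (2 / \<beta> - 1 / (\<beta> + \<delta>) - 1 / (\<beta> - \<delta>))) {-\<delta>..\<delta>}"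
proof -
  have L: "((\<lambda>u. - sgn u / (\<beta> - u)\<^sup>2) has_integral (1 / \<beta> - 1 / (\<beta> + \<delta>))) {-\<delta>..0}"
    by (rule has_integral_spike[OF _ _ has_integral_inverse_square[of "-\<delta>" 0 \<beta>, simplified], of "{0}"])
       (use assms in auto)
  have R: "((\<lambda>u. - sgn u / (\<beta> - u)\<^sup>2) has_integral - (1 / (\<beta> - \<delta>) - 1 / \<beta>)) {0..\<delta>}"
    by (rule has_integral_spike[OF _ _ has_integral_neg[OF has_integral_inverse_square[of 0 \<delta> \<beta>, simplified]], of "{0}"])
       (use assms in auto)
  show ?thesis
    using has_integral_combine[OF _ _ L R] assms by (simp add: algebra_simps)
qed

text \<open>
  The substitution \<open>u = \<beta> - C exp (- \<mu> s)\<close> turns the weight \<open>exp (\<mu> s)\<close> into the weight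
  \<open>1 / (\<beta> - u)\<^sup>2\<close> of the smoothing condition.
\<close>

lemma crossing_integral:
  fixes g :: "real \<Rightarrow> real"
  assumes pos: "0 < \<mu>" "0 < C" "0 < \<delta>" "\<delta> < \<beta>" and "l \<le> r" and g: "continuous_on UNIV g"
    and g1: "\<And>u. u \<le> -\<delta> \<Longrightarrow> g u = 1" and g2: "\<And>u. \<delta> \<le> u \<Longrightarrow> g u = -1"
    and l: "\<beta> - C * exp (- \<mu> * l) \<le> -\<delta>" and r: "\<delta> \<le> \<beta> - C * exp (- \<mu> * r)"
  shows "integral {l..r} (\<lambda>s. exp (\<mu> * s) * g (\<beta> - C * exp (- \<mu> * s)))
    = (2 * C / \<beta> - exp (\<mu> * l) - exp (\<mu> * r) + C * feedback_defect \<beta> \<delta> g) / \<mu>"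
proof -
  define Y where "Y s = \<beta> - C * exp (- \<mu> * s)" for s
  define G where "G u = g u / (\<beta> - u)\<^sup>2" for u
  have Y: "\<beta> - Y s = C * exp (- \<mu> * s)" for s by (simp add: Y_def)
  have less: "Y s < \<beta>" for s using pos by (simp add: Y_def)
  have inv: "1 / (\<beta> - Y s) = exp (\<mu> * s) / C" for s
    using pos by (simp add: Y exp_minus field_simps)
  have contG: "continuous_on {Y l..Y r} G"
    unfolding G_def using less[of r]
    by (intro continuous_intros continuous_on_subset[OF g]) auto
  have sub: "((\<lambda>s. (\<mu> * C * exp (- \<mu> * s)) *\<^sub>R G (Y s)) has_integral integral {Y l..Y r} G) {l..r}"
  proof (rule has_integral_substitution[where c = "Y l" and d = "Y r"])
    have mono: "Y s \<le> Y t" if "s \<le> t" for s t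
      using that pos by (simp add: Y_def)
    then show "Y l \<le> Y r" "Y ` {l..r} \<subseteq> {Y l..Y r}" using \<open>l \<le> r\<close> by auto
    show "(Y has_real_derivative \<mu> * C * exp (- \<mu> * s)) (at s within {l..r})" for s
      unfolding Y_def by (auto intro!: derivative_eq_intros)
  qed (use contG \<open>l \<le> r\<close> in auto)
  have eq: "(\<mu> * C * exp (- \<mu> * s)) *\<^sub>R G (Y s) = (\<mu> / C) * (exp (\<mu> * s) * g (Y s))" for s
    using pos by (simp add: G_def Y power2_eq_square exp_minus field_simps)
  have "integral {l..r} (\<lambda>s. exp (\<mu> * s) * g (Y s)) = C / \<mu> * integral {Y l..Y r} G"
  proof -
    have "((\<lambda>s. (\<mu> / C) * (exp (\<mu> * s) * g (Y s))) has_integral integral {Y l..Y r} G) {l..r}"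
      using sub unfolding eq .
    from has_integral_mult_right[OF this, of "C / \<mu>"] show ?thesis
      using pos by (intro integral_unique) simp
  qed
  \<comment> \<open>Outside the band \<open>g\<close> is 1 or -1, so \<open>G\<close> integrates to
    differences of \<open>1 / (\<beta> - u)\<close>; the piece over the band stays
    unevaluated.\<close>
  also have "integral {Y l..Y r} G = (1 / (\<beta> + \<delta>) - 1 / (\<beta> - Y l)) + integral {-\<delta>..\<delta>} G
      - (1 / (\<beta> - Y r) - 1 / (\<beta> - \<delta>))"
  proof -
    have "(G has_integral (1 / (\<beta> + \<delta>) - 1 / (\<beta> - Y l))) {Y l..-\<delta>}"
      using has_integral_inverse_square[of "Y l" "-\<delta>" \<beta>] l pos
      by (subst has_integral_cong[where g = "\<lambda>u. 1 / (\<beta> - u)\<^sup>2"]) (auto simp: G_def g1 Y_def)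
    moreover have "(G has_integral integral {-\<delta>..\<delta>} G) {-\<delta>..\<delta>}"
      using l r pos by (intro integrable_integral integrable_continuous_real continuous_on_subset[OF contG])
         (auto simp: Y_def)
    moreover have "(G has_integral - (1 / (\<beta> - Y r) - 1 / (\<beta> - \<delta>))) {\<delta>..Y r}"
      using has_integral_neg[OF has_integral_inverse_square[of \<delta> "Y r" \<beta>]] r less[of r]
      by (subst has_integral_cong[where g = "\<lambda>u. - (1 / (\<beta> - u)\<^sup>2)"]) (auto simp: G_def g2 Y_def)
    ultimately have "(G has_integral (1 / (\<beta> + \<delta>) - 1 / (\<beta> - Y l)) + integral {-\<delta>..\<delta>} G
        + - (1 / (\<beta> - Y r) - 1 / (\<beta> - \<delta>))) {Y l..Y r}"
      using l r pos by (intro has_integral_combine[of "Y l" \<delta> "Y r"] has_integral_combine[of "Y l" "-\<delta>" \<delta>])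
         (auto simp: Y_def)
    then show ?thesis by (simp add: integral_unique)
  qed
  \<comment> \<open>The end terms at \<open>-\<delta>\<close> and \<open>\<delta>\<close> cancel
    against those in the integral for \<open>- sgn\<close>.\<close>
  also have "\<dots> = 2 / \<beta> - 1 / (\<beta> - Y l) - 1 / (\<beta> - Y r) + feedback_defect \<beta> \<delta> g"
    using integral_unique[OF has_integral_sgn_inverse_square[of \<delta> \<beta>]] pos
    by (simp add: feedback_defect_def G_def[abs_def])
  also have "C / \<mu> * \<dots> = (2 * C / \<beta> - exp (\<mu> * l) - exp (\<mu> * r) + C * feedback_defect \<beta> \<delta> g) / \<mu>"
    using pos unfolding inv by (simp add: field_simps)
  finally show ?thesis by (simp add: Y_def)
qed

text \<open>The numerators differ by at most 2 and \<open>\<beta> - u \<ge> \<beta> / 2\<close> on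
  the band, so the integrand is at most \<open>8 / \<beta>\<^sup>2\<close> over a length of
  \<open>2 * \<delta>\<close>.\<close>

lemma feedback_defect_bound:
  assumes "0 < \<delta>" "\<delta> \<le> \<beta> / 2" and g: "continuous_on UNIV g" and "\<And>u. \<bar>u\<bar> \<le> \<delta> \<Longrightarrow> \<bar>g u\<bar> \<le> 1"
  shows "\<bar>feedback_defect \<beta> \<delta> g\<bar> \<le> 16 * \<delta> / \<beta>\<^sup>2"
proof -
  have G: "((\<lambda>u. g u / (\<beta> - u)\<^sup>2) has_integral integral {-\<delta>..\<delta>} (\<lambda>u. g u / (\<beta> - u)\<^sup>2)) {-\<delta>..\<delta>}"
    using assms by (intro integrable_integral integrable_continuous_real continuous_intros continuous_on_subset[OF g]) auto
  have S: "((\<lambda>u. - sgn u / (\<beta> - u)\<^sup>2) has_integral integral {-\<delta>..\<delta>} (\<lambda>u. - sgn u / (\<beta> - u)\<^sup>2)) {-\<delta>..\<delta>}"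
    by (intro integrable_integral has_integral_integrable[OF has_integral_sgn_inverse_square])
       (use assms in auto)
  have "norm (feedback_defect \<beta> \<delta> g) \<le> 8 / \<beta>\<^sup>2 * Henstock_Kurzweil_Integration.content (cbox (-\<delta>) \<delta>)"
    unfolding feedback_defect_def
  proof (rule has_integral_bound)
    show "((\<lambda>u. g u / (\<beta> - u)\<^sup>2 - (- sgn u / (\<beta> - u)\<^sup>2)) has_integral
      integral {-\<delta>..\<delta>} (\<lambda>u. g u / (\<beta> - u)\<^sup>2) - integral {-\<delta>..\<delta>} (\<lambda>u. - sgn u / (\<beta> - u)\<^sup>2)) (cbox (-\<delta>) \<delta>)"
      using has_integral_diff[OF G S] by simp
    fix u assume "u \<in> cbox (-\<delta>) \<delta>"
    then have u: "\<bar>u\<bar> \<le> \<delta>" by auto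
    have "\<bar>g u + sgn u\<bar> \<le> 2" using assms(4)[OF u] by (auto simp: sgn_if)
    moreover have "(\<beta> / 2)\<^sup>2 \<le> (\<beta> - u)\<^sup>2"
      using u assms by (intro power_mono) auto
    moreover have "0 < (\<beta> / 2)\<^sup>2" using assms by auto
    ultimately have "\<bar>g u + sgn u\<bar> / (\<beta> - u)\<^sup>2 \<le> 2 / (\<beta> / 2)\<^sup>2"
      by (intro frac_le) auto
    then show "norm (g u / (\<beta> - u)\<^sup>2 - (- sgn u / (\<beta> - u)\<^sup>2)) \<le> 8 / \<beta>\<^sup>2"
      by (simp add: add_divide_distrib[symmetric] power2_eq_square)
  qed auto
  also have "\<dots> = 16 * \<delta> / \<beta>\<^sup>2"
    using assms by simp
  finally show ?thesis by simp
qed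

text \<open>Reflection moves the pole from \<open>\<beta>\<close> to \<open>- \<beta>\<close>. With
  \<open>\<beta> = a1 / \<mu>\<close> the right-hand side vanishes by the smoothing condition, so a
  falling crossing can be treated as a rising one for the reflected feedback.\<close>

lemma feedback_defect_reflect:
  "feedback_defect \<beta> \<delta> (\<lambda>u. - g (- u)) =
    integral {-\<delta>..\<delta>} (\<lambda>u. - sgn u / (- \<beta> - u)\<^sup>2) - integral {-\<delta>..\<delta>} (\<lambda>u. g u / (- \<beta> - u)\<^sup>2)"
proof -
  have refl: "integral {-\<delta>..\<delta>} (\<lambda>u. F (- u)) = integral {-\<delta>..\<delta>} F" for F :: "real \<Rightarrow> real"
    using Henstock_Kurzweil_Integration.integral_reflect_real[of \<delta> "-\<delta>" F] by simp
  have "(\<beta> + u)\<^sup>2 = (- \<beta> - u)\<^sup>2" for u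
    by (simp add: power2_eq_square algebra_simps)
  then show ?thesis
    using refl[of "\<lambda>u. - g u / (- \<beta> - u)\<^sup>2"] refl[of "\<lambda>u. sgn u / (- \<beta> - u)\<^sup>2"]
    by (simp add: feedback_defect_def power2_commute[of \<beta>])
qed

section \<open>Solutions over one period\<close>

lemma C_infinity_derivative:
  assumes "C_infinity g"
  shows "(g has_real_derivative deriv g x) (at x)" "continuous_on S (deriv g)" "continuous_on S g"
proof -
  have "g differentiable_on UNIV" "deriv g differentiable_on UNIV"
    using assms[unfolded C_infinity_def, rule_format, of 0] assms[unfolded C_infinity_def, rule_format, of 1]
    by simp_all
  then show "(g has_real_derivative deriv g x) (at x)" "continuous_on S (deriv g)" "continuous_on S g"
    by (auto simp: differentiable_on_def real_differentiable_def DERIV_deriv_iff_real_differentiable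
        intro!: continuous_at_imp_continuous_on differentiable_imp_continuous_within)
qed

text \<open>
  The times \<open>\<tau>\<close> and \<open>\<sigma>\<close> are the reference zeros \<open>t\<^sub>1(h\<^sub>*)\<close> and \<open>t\<^sub>2(h\<^sub>*)\<close>; solutions cross the band
  \<open>[-\<delta>, \<delta>]\<close> within \<open>\<epsilon>1\<close> of \<open>\<tau>\<close> and within \<open>\<epsilon>2\<close> of \<open>\<sigma>\<close>.
\<close>

locale smoothed_equation =
  fixes \<mu> a1 a2 p1 p2 \<delta> \<rho> \<tau> \<sigma> \<epsilon>1 \<epsilon>2 :: real and a f :: "real \<Rightarrow> real"
  assumes pos: "0 < \<mu>" "0 < a1" "0 < a2" "0 < p1" "0 < p2" "0 < \<delta>" "0 < \<rho>" "0 < \<epsilon>1" "0 < \<epsilon>2"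
    and feedback: "smoothed_feedback \<mu> a1 \<delta> f"
    and coefficient: "smoothed_coefficient \<mu> a1 a2 p1 p2 \<rho> a"
    and times: "\<rho> \<le> \<tau> - \<epsilon>1" "2 * \<epsilon>1 \<le> 1" "\<tau> + 1 + \<epsilon>1 \<le> \<sigma> - \<epsilon>2" "\<sigma> + \<epsilon>2 \<le> p1"
      "p1 + \<rho> \<le> \<sigma> + 1 - \<epsilon>2" "\<sigma> + 1 + \<epsilon>2 \<le> p1 + p2"
    and small: "\<delta> < a1 / \<mu>"
begin

abbreviation "T \<equiv> p1 + p2"
abbreviation "\<beta> \<equiv> a1 / \<mu>"

lemma f_smooth: "C_infinity f"
  using feedback by (simp add: smoothed_feedback_def)

lemma a_smooth: "C_infinity a"
  using coefficient by (simp add: smoothed_coefficient_def)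

sublocale scalar_dde \<mu> a f
  by standard (use C_infinity_derivative f_smooth a_smooth in auto)

lemma f_high: "\<delta> \<le> u \<Longrightarrow> f u = -1"
  using feedback pos by (auto simp: smoothed_feedback_def sgn_if)

lemma f_low: "u \<le> -\<delta> \<Longrightarrow> f u = 1"
  using feedback pos by (auto simp: smoothed_feedback_def sgn_if)

lemma f_bounded: "\<bar>f u\<bar> \<le> 1"
  using feedback f_high[of u] f_low[of u] unfolding smoothed_feedback_def
  by (metis abs_le_iff abs_neg_one abs_one linorder_le_cases minus_le_iff order_refl)

lemma a_periodic: "a (t + T) = a t"
  using coefficient by (simp add: smoothed_coefficient_def)

lemma a_first: "\<rho> \<le> t \<Longrightarrow> t \<le> p1 \<Longrightarrow> a t = a1"
  using coefficient by (auto simp: smoothed_coefficient_def)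

lemma a_second: "p1 + \<rho> \<le> t \<Longrightarrow> t \<le> T \<Longrightarrow> a t = a2"
  using coefficient by (auto simp: smoothed_coefficient_def)

lemma a_positive: "0 \<le> t \<Longrightarrow> t \<le> T \<Longrightarrow> 0 < a t"
proof -
  assume t: "0 \<le> t" "t \<le> T"
  have *: "\<forall>t\<in>{0..\<rho>} \<union> {p1..p1+\<rho>}. 0 < a t \<and> a t \<le> 2 * max a1 a2"
    using coefficient by (simp add: smoothed_coefficient_def)
  consider "t \<le> \<rho>" | "\<rho> \<le> t" "t \<le> p1" | "p1 \<le> t" "t \<le> p1 + \<rho>" | "p1 + \<rho> \<le> t" by linarith
  then show "0 < a t"
    using t * a_first a_second pos by cases auto
qed

text \<open>Feedback equal to \<open>c\<close> on \<open>[r, t]\<close> changes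
  \<open>exp (\<mu> * t) * x t\<close> by \<open>c * (B t - B r)\<close>; \<open>E\<close> plays the
  role of \<open>B\<close> for the constant coefficient 1.\<close>

definition W :: "real \<Rightarrow> real" where "W s = a s * exp (\<mu> * s)"
definition B :: "real \<Rightarrow> real" where "B t = integral {0..t} W"
definition E :: "real \<Rightarrow> real" where "E t = (exp (\<mu> * t) - 1) / \<mu>"

lemma E_mono: "s \<le> t \<Longrightarrow> E s \<le> E t"
  using pos by (simp add: E_def divide_right_mono)

lemma E_pos: "0 < t \<Longrightarrow> 0 < E t"
  using pos by (simp add: E_def)

lemma continuous_W: "continuous_on S W"
  unfolding W_def by (intro continuous_intros)

lemma integral_exp: "r \<le> t \<Longrightarrow> ((\<lambda>s. exp (\<mu> * s)) has_integral (E t - E r)) {r..t}"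
  by (rule fundamental_theorem_of_calculus)
     (use pos in \<open>auto intro!: derivative_eq_intros simp: E_def
        simp flip: has_real_derivative_iff_has_vector_derivative\<close>)

lemma integral_W: "0 \<le> r \<Longrightarrow> r \<le> t \<Longrightarrow> (W has_integral (B t - B r)) {r..t}"
proof -
  assume rt: "0 \<le> r" "r \<le> t"
  have int: "W integrable_on {c..d}" for c d
    by (intro integrable_continuous_real continuous_W)
  have "B t = B r + integral {r..t} W"
    unfolding B_def using Henstock_Kurzweil_Integration.integral_combine[OF rt int] by simp
  then show ?thesis using integrable_integral[OF int, of r t] by simp
qed

lemma B_const:
  assumes "0 \<le> r" "r \<le> t" "\<And>s. r \<le> s \<Longrightarrow> s \<le> t \<Longrightarrow> a s = c"
  shows "B t - B r = c * (E t - E r)"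
proof -
  have "((\<lambda>s. c * exp (\<mu> * s)) has_integral c * (E t - E r)) {r..t}"
    by (intro has_integral_mult_right integral_exp assms)
  then have "(W has_integral c * (E t - E r)) {r..t}"
    by (rule has_integral_eq[rotated]) (use assms in \<open>auto simp: W_def\<close>)
  then show ?thesis using has_integral_unique integral_W assms by blast
qed

text \<open>The moment condition on \<open>[0, \<rho>]\<close> compares \<open>a\<close> with
  \<open>a1\<close> under exactly the weight \<open>exp (\<mu> * s)\<close>, so the transition
  leaves no trace in \<open>B\<close> once it is over.\<close>

lemma B_first: "\<rho> \<le> t \<Longrightarrow> t \<le> p1 \<Longrightarrow> B t = a1 * E t"
proof -
  assume t: "\<rho> \<le> t" "t \<le> p1"
  have "B \<rho> = a1 * integral {0..\<rho>} (\<lambda>s. exp (\<mu> * s))"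
    using coefficient by (simp add: B_def W_def[abs_def] smoothed_coefficient_def)
  also have "\<dots> = a1 * E \<rho>"
    using integral_unique[OF integral_exp[of 0 \<rho>]] pos by (simp add: E_def)
  finally show ?thesis
    using B_const[of \<rho> t a1] t pos a_first by (auto simp: algebra_simps)
qed

lemma B_second: "p1 + \<rho> \<le> t \<Longrightarrow> t \<le> T \<Longrightarrow> B t = a1 * E p1 + a2 * (E t - E p1)"
proof -
  assume t: "p1 + \<rho> \<le> t" "t \<le> T"
  have "B (p1 + \<rho>) - B p1 = integral {p1..p1+\<rho>} W"
    using integral_unique[OF integral_W[of p1 "p1 + \<rho>"]] pos by simp
  also have "\<dots> = a2 * integral {p1..p1+\<rho>} (\<lambda>s. exp (\<mu> * s))"
    using coefficient by (simp add: W_def[abs_def] smoothed_coefficient_def)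
  also have "\<dots> = a2 * (E (p1 + \<rho>) - E p1)"
    using integral_unique[OF integral_exp[of p1 "p1 + \<rho>"]] pos by simp
  finally show ?thesis
    using B_const[of "p1 + \<rho>" t a2] t pos a_second B_first[of p1] times by (auto simp: algebra_simps)
qed

lemma B_mono: "0 \<le> r \<Longrightarrow> r \<le> t \<Longrightarrow> t \<le> T \<Longrightarrow> B r \<le> B t"
proof -
  assume rt: "0 \<le> r" "r \<le> t" "t \<le> T"
  have "0 \<le> B t - B r"
    by (rule has_integral_nonneg[OF integral_W]) (use rt a_positive in \<open>auto simp: W_def less_imp_le\<close>)
  then show ?thesis by simp
qed

lemma continuous_B: "continuous_on {0..} B"
  unfolding B_def by (rule continuous_on_integral_atLeast[OF continuous_W])

lemma integral_feedback_const:
  assumes "0 \<le> r" "r \<le> t" "\<And>s. r \<le> s \<Longrightarrow> s \<le> t \<Longrightarrow> g s = c"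
  shows "integral {r..t} (\<lambda>s. W s * g s) = c * (B t - B r)"
proof -
  have "integral {r..t} (\<lambda>s. W s * g s) = integral {r..t} (\<lambda>s. c * W s)"
    by (rule integral_cong) (use assms in auto)
  also have "\<dots> = c * (B t - B r)"
    using integral_unique[OF integral_W[OF assms(1,2)]] by simp
  finally show ?thesis .
qed

lemma integral_feedback_bound:
  assumes "0 \<le> r" "r \<le> t" "t \<le> T" "continuous_on {r..t} g" "\<And>s. \<bar>g s\<bar> \<le> 1"
  shows "\<bar>integral {r..t} (\<lambda>s. W s * g s)\<bar> \<le> B t - B r"
proof -
  have "norm (integral {r..t} (\<lambda>s. W s * g s)) \<le> integral {r..t} W"
  proof (rule integral_norm_bound_integral)
    fix s assume "s \<in> {r..t}"
    then have "0 \<le> W s" using a_positive[of s] assms by (simp add: W_def)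
    then show "norm (W s * g s) \<le> W s"
      using assms(5)[of s] by (simp add: abs_mult mult_left_le)
  qed (use assms in \<open>auto intro!: integrable_continuous_real continuous_intros continuous_W\<close>)
  then show ?thesis using integral_unique[OF integral_W[OF assms(1,2)]] by simp
qed

lemma above_band: "\<delta> * exp (\<mu> * T) < exp (\<mu> * t) * u \<Longrightarrow> t \<le> T \<Longrightarrow> \<delta> < u"
proof -
  assume *: "\<delta> * exp (\<mu> * T) < exp (\<mu> * t) * u" and "t \<le> T"
  then have "\<delta> * exp (\<mu> * t) \<le> \<delta> * exp (\<mu> * T)" using pos by simp
  with * have "exp (\<mu> * t) * \<delta> < exp (\<mu> * t) * u" by (metis mult.commute order.strict_trans1)
  then show ?thesis by simp
qed

lemma below_band: "exp (\<mu> * t) * u < - (\<delta> * exp (\<mu> * T)) \<Longrightarrow> t \<le> T \<Longrightarrow> u < -\<delta>"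
  using above_band[of t "-u"] by simp

text \<open>
  Between the two crossings \<open>exp (\<mu> t) x(t) = A h + B t\<close>, so that \<open>y2\<close> is the solution there. From the
  second crossing on the feedback only depends on the delayed value through \<open>y2\<close>, because \<open>x\<close> and \<open>y2\<close>
  both stay above the band afterwards; this makes \<open>y3\<close> the solution up to time \<open>T\<close>.
\<close>

definition A :: "real \<Rightarrow> real"
  where "A h = h * (1 - 2 * exp \<mu>) - 2 * a1 * (exp \<mu> - 1) / \<mu>"

definition y2 :: "real \<Rightarrow> real \<Rightarrow> real"
  where "y2 h t = exp (- \<mu> * t) * (A h + B t)"

definition w3 :: "real \<Rightarrow> real \<Rightarrow> real"
  where "w3 h t = A h + B 1 + integral {1..t} (\<lambda>s. W s * f (y2 h (s - 1)))"

definition y3 :: "real \<Rightarrow> real \<Rightarrow> real"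
  where "y3 h t = exp (- \<mu> * t) * w3 h t"

text \<open>
  In each inequality the side without \<open>\<delta>\<close> is \<open>exp (\<mu> t) x(t)\<close>, or a bound for it, at the end of a
  monotone phase; the factor \<open>exp (\<mu> T)\<close> dominates all \<open>exp (\<mu> t)\<close>.
\<close>

definition crossing :: "real \<Rightarrow> bool"
  where "crossing h \<longleftrightarrow>
    \<delta> * exp (\<mu> * T) < h - a1 * E (\<tau> - \<epsilon>1) \<and>
    h - a1 * E (\<tau> + \<epsilon>1) < - (\<delta> * exp (\<mu> * T)) \<and>
    h - 2 * a1 * E (\<tau> + 1 - \<epsilon>1) + a1 * E (\<sigma> - \<epsilon>2) < - (\<delta> * exp (\<mu> * T)) \<and>
    A h + a1 * E (\<sigma> - \<epsilon>2) < - (\<delta> * exp (\<mu> * T)) \<and>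
    \<delta> * exp (\<mu> * T) < A h + a1 * E (\<sigma> + \<epsilon>2) \<and>
    \<delta> * exp (\<mu> * T) < A h + 2 * B (\<sigma> + 1 - \<epsilon>2) - B T"

lemma exp_y2: "exp (\<mu> * t) * y2 h t = A h + B t"
  by (simp add: y2_def exp_minus)

lemma exp_y3: "exp (\<mu> * t) * y3 h t = w3 h t"
  by (simp add: y3_def exp_minus)

lemma continuous_y2: "continuous_on {0..} (y2 h)"
  unfolding y2_def by (intro continuous_intros continuous_B)

lemma continuous_f_y2: "continuous_on {1..} (\<lambda>s. f (y2 h (s - 1)))"
  by (intro continuous_intros continuous_on_compose2[OF continuous_y2]) auto

lemma continuous_w3: "continuous_on {1..} (w3 h)"
  unfolding w3_def
  by (intro continuous_intros continuous_on_integral_atLeast continuous_W continuous_f_y2)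

lemma continuous_y3: "continuous_on {1..} (y3 h)"
  unfolding y3_def by (intro continuous_intros continuous_w3)

lemma w3_split: "1 \<le> r \<Longrightarrow> r \<le> t \<Longrightarrow> w3 h t = w3 h r + integral {r..t} (\<lambda>s. W s * f (y2 h (s - 1)))"
  unfolding w3_def
  by (subst Henstock_Kurzweil_Integration.integral_combine[where c = r, symmetric])
     (auto intro!: integrable_continuous_real continuous_intros continuous_W
        continuous_on_subset[OF continuous_f_y2])

lemma y2_low:
  assumes "crossing h" "0 \<le> t" "t \<le> \<sigma> - \<epsilon>2"
  shows "y2 h t < -\<delta>"
proof (rule below_band)
  have "A h + B t \<le> A h + B (\<sigma> - \<epsilon>2)"
    using B_mono[of t "\<sigma> - \<epsilon>2"] assms times pos by simp
  also have "\<dots> < - (\<delta> * exp (\<mu> * T))"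
    using assms times pos by (simp add: crossing_def B_first)
  finally show "exp (\<mu> * t) * y2 h t < - (\<delta> * exp (\<mu> * T))" by (simp add: exp_y2)
qed (use assms times pos in auto)

lemma y2_high:
  assumes "crossing h" "\<sigma> + \<epsilon>2 \<le> t" "t \<le> T"
  shows "\<delta> < y2 h t"
proof (rule above_band)
  have "\<delta> * exp (\<mu> * T) < A h + B (\<sigma> + \<epsilon>2)"
    using assms times pos by (simp add: crossing_def B_first)
  also have "\<dots> \<le> A h + B t"
    using B_mono[of "\<sigma> + \<epsilon>2" t] assms times pos by simp
  finally show "\<delta> * exp (\<mu> * T) < exp (\<mu> * t) * y2 h t" by (simp add: exp_y2)
qed (use assms in auto)

text \<open>\<open>y2\<close> lies below the band from time 0 on, even where it is not yet the
  solution, so the feedback inside \<open>w3\<close> is 1 until one unit after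
  \<open>\<sigma> - \<epsilon>2\<close>.\<close>

lemma w3_early:
  assumes "crossing h" "1 \<le> t" "t \<le> \<sigma> - \<epsilon>2 + 1"
  shows "w3 h t = A h + B t"
  unfolding w3_def
  by (subst integral_feedback_const[where c = 1])
     (use assms y2_low[OF assms(1)] f_low in \<open>auto simp: less_imp_le\<close>)

text \<open>Up to \<open>\<sigma> + 1 - \<epsilon>2\<close> the feedback is 1 and \<open>w3\<close>
  grows. Afterwards only \<open>\<bar>f\<bar> \<le> 1\<close> is used: the loss is at most
  \<open>B T - B (\<sigma> + 1 - \<epsilon>2)\<close>, which is the origin of the last condition in
  \<open>crossing\<close>.\<close>

lemma w3_lower:
  assumes h: "crossing h" and t: "\<sigma> + \<epsilon>2 \<le> t" "t \<le> T"
  shows "\<delta> * exp (\<mu> * T) < w3 h t"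
proof (cases "t \<le> \<sigma> + 1 - \<epsilon>2")
  case True
  have "\<delta> * exp (\<mu> * T) < A h + B (\<sigma> + \<epsilon>2)"
    using h times pos by (simp add: crossing_def B_first)
  also have "\<dots> \<le> A h + B t"
    using B_mono[of "\<sigma> + \<epsilon>2" t] t times pos by simp
  also have "\<dots> = w3 h t"
    using w3_early[OF h, of t] True times pos t by simp
  finally show ?thesis .
next
  case False
  let ?r = "\<sigma> + 1 - \<epsilon>2"
  have r: "1 \<le> ?r" "?r \<le> t" using False times pos by auto
  have cont: "continuous_on {?r..t} (\<lambda>s. f (y2 h (s - 1)))"
    by (rule continuous_on_subset[OF continuous_f_y2]) (use r in auto)
  have "\<bar>integral {?r..t} (\<lambda>s. W s * f (y2 h (s - 1)))\<bar> \<le> B t - B ?r"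
    by (rule integral_feedback_bound) (use r t cont f_bounded in auto)
  moreover have "w3 h t = A h + B ?r + integral {?r..t} (\<lambda>s. W s * f (y2 h (s - 1)))"
    using w3_split[OF r, of h] w3_early[OF h, of ?r] r by simp
  moreover have "B t \<le> B T" using B_mono[of t T] t r by simp
  moreover have "\<delta> * exp (\<mu> * T) < A h + 2 * B ?r - B T"
    using h by (simp add: crossing_def)
  ultimately show ?thesis by linarith
qed

section \<open>A solution followed through both crossings\<close>

context
  fixes h \<phi> x
  assumes h: "crossing h" and x: "solves \<phi> x"
    and initial: "\<And>s. \<delta> \<le> apply_bcontfun \<phi> s" "apply_bcontfun \<phi> (Abs_lag 0) = h"
begin

lemma w_step:
  assumes "0 \<le> r" "r \<le> t"
  shows "exp (\<mu> * t) * x t = exp (\<mu> * r) * x r + integral {r..t} (\<lambda>s. W s * f (x (s - 1)))"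
  using variation_of_constants[OF x assms] by (simp add: forcing_def[abs_def] W_def)

text \<open>As long as the delayed value is above the band the feedback is -1, and the formula
  itself, one unit earlier, shows that it is above. The explicit phase thus lasts one unit beyond
  \<open>\<tau> - \<epsilon>1\<close>.\<close>

lemma phase1:
  assumes "0 \<le> t" "t \<le> \<tau> - \<epsilon>1 + 1"
  shows "exp (\<mu> * t) * x t = h - B t"
  using assms
proof (induction t rule: unit_step_induct)
  case (step t)
  have fx: "f (x (s - 1)) = -1" if s: "0 \<le> s" "s \<le> t" for s
  proof (cases "s \<le> 1")
    case True
    then show ?thesis
      using s solves_initial[OF x, of "s - 1"] initial f_high by simp
  next
    case False
    have "\<delta> * exp (\<mu> * T) < h - B (\<tau> - \<epsilon>1)"
      using h times pos by (simp add: crossing_def B_first)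
    also have "\<dots> \<le> h - B (s - 1)"
      using B_mono[of "s - 1" "\<tau> - \<epsilon>1"] False s step times pos by simp
    also have "\<dots> = exp (\<mu> * (s - 1)) * x (s - 1)"
      using step(2)[of "s - 1"] False s step(1,3) by simp
    finally show ?thesis
      using above_band f_high step(3) s times pos by (simp add: less_imp_le)
  qed
  have "x 0 = h" using solves_initial[OF x, of 0] initial by simp
  moreover have "integral {0..t} (\<lambda>s. W s * f (x (s - 1))) = -1 * (B t - B 0)"
    by (rule integral_feedback_const) (use fx step in auto)
  ultimately show ?case
    using w_step[of 0 t] step by (simp add: B_def)
qed

lemma x_high1: "-1 \<le> t \<Longrightarrow> t \<le> \<tau> - \<epsilon>1 \<Longrightarrow> \<delta> \<le> x t"
proof -
  assume t: "-1 \<le> t" "t \<le> \<tau> - \<epsilon>1"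
  show "\<delta> \<le> x t"
  proof (cases "t \<le> 0")
    case True
    then show ?thesis using solves_initial[OF x, of t] t initial by simp
  next
    case False
    have "\<delta> * exp (\<mu> * T) < h - B (\<tau> - \<epsilon>1)"
      using h times pos by (simp add: crossing_def B_first)
    also have "\<dots> \<le> exp (\<mu> * t) * x t"
      using B_mono[of t "\<tau> - \<epsilon>1"] False t phase1[of t] times pos by simp
    finally show ?thesis
      using above_band[of t "x t"] t times pos by simp
  qed
qed

text \<open>Up to \<open>\<tau> - \<epsilon>1 + 1\<close> the explicit formula decreases. After that
  the delayed value passes the band and only \<open>\<bar>f\<bar> \<le> 1\<close> is used: the
  regain is at most \<open>B t - B (\<tau> + 1 - \<epsilon>1)\<close>, which is the third condition
  in \<open>crossing\<close>.\<close>

lemma x_low: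
  assumes t: "\<tau> + \<epsilon>1 \<le> t" "t \<le> \<sigma> - \<epsilon>2"
  shows "x t < -\<delta>"
proof (rule below_band)
  show "exp (\<mu> * t) * x t < - (\<delta> * exp (\<mu> * T))"
  proof (cases "t \<le> \<tau> - \<epsilon>1 + 1")
    case True
    have "exp (\<mu> * t) * x t = h - B t"
      using phase1 True t times pos by simp
    also have "\<dots> \<le> h - B (\<tau> + \<epsilon>1)"
      using B_mono[of "\<tau> + \<epsilon>1" t] t times pos by simp
    also have "\<dots> < - (\<delta> * exp (\<mu> * T))"
      using h times pos by (simp add: crossing_def B_first)
    finally show ?thesis .
  next
    case False
    let ?r = "\<tau> + 1 - \<epsilon>1"
    have r: "0 \<le> ?r" "?r \<le> t" "\<rho> \<le> ?r" using False times pos by auto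
    have "continuous_on {?r..t} (\<lambda>s. f (x (s - 1)))"
      by (intro continuous_intros continuous_on_compose2[OF solves_continuous[OF x]]) (use r in auto)
    then have "\<bar>integral {?r..t} (\<lambda>s. W s * f (x (s - 1)))\<bar> \<le> B t - B ?r"
      by (intro integral_feedback_bound) (use r t times pos f_bounded in auto)
    then have "exp (\<mu> * t) * x t \<le> h - B ?r + (B t - B ?r)"
      using w_step[OF r(1,2)] phase1[of ?r] r by simp
    also have "\<dots> = h - 2 * a1 * E ?r + a1 * E t"
      using r t times pos by (simp add: B_first)
    also have "\<dots> \<le> h - 2 * a1 * E ?r + a1 * E (\<sigma> - \<epsilon>2)"
      using E_mono[OF t(2)] pos by simp
    also have "\<dots> < - (\<delta> * exp (\<mu> * T))"
      using h by (simp add: crossing_def)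
    finally show ?thesis .
  qed
qed (use t times pos in auto)

text \<open>While the delayed value crosses the band, \<open>- x\<close> rises towards
  \<open>\<beta>\<close> with amplitude \<open>\<beta> + h\<close>. The reflected feedback
  \<open>g\<close> has defect 0, so the result is that of the discontinuous equation, whatever the
  shape of \<open>f\<close>.\<close>

lemma phase2: "exp (\<mu> * (\<tau> + 1 + \<epsilon>1)) * x (\<tau> + 1 + \<epsilon>1) = A h + B (\<tau> + 1 + \<epsilon>1)"
proof -
  let ?l = "\<tau> - \<epsilon>1" and ?r = "\<tau> + \<epsilon>1"
  define g where "g u = - f (- u)" for u
  have x1: "x s = - (\<beta> - (\<beta> + h) * exp (- \<mu> * s))" if "?l \<le> s" "s \<le> ?r" for s
  proof -
    have "exp (\<mu> * s) * x s = h - a1 * E s"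
      using phase1[of s] B_first[of s] that times pos by simp
    then have "x s = (h - a1 * E s) * exp (- \<mu> * s)"
      by (simp add: exp_minus field_simps)
    then show ?thesis using pos by (simp add: E_def exp_minus field_simps)
  qed
  have defect: "feedback_defect \<beta> \<delta> g = 0"
    using feedback by (simp add: g_def[abs_def] feedback_defect_reflect smoothed_feedback_def Let_def)
  have cross: "integral {?l..?r} (\<lambda>s. exp (\<mu> * s) * g (\<beta> - (\<beta> + h) * exp (- \<mu> * s)))
    = (2 * (\<beta> + h) / \<beta> - exp (\<mu> * ?l) - exp (\<mu> * ?r) + (\<beta> + h) * feedback_defect \<beta> \<delta> g) / \<mu>"
  proof (rule crossing_integral)
    show "0 < \<beta> + h"
      using h E_pos[of ?l] times pos small
      by (simp add: crossing_def) (smt (verit) exp_gt_zero mult_pos_pos divide_pos_pos)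
    show "continuous_on UNIV g"
      unfolding g_def by (intro continuous_intros)
    show "\<beta> - (\<beta> + h) * exp (- \<mu> * ?l) \<le> -\<delta>"
      using x_high1[of ?l] x1[of ?l] times pos by simp
    show "\<delta> \<le> \<beta> - (\<beta> + h) * exp (- \<mu> * ?r)"
      using x_low[of ?r] x1[of ?r] times pos by simp
  qed (use pos small f_low f_high in \<open>auto simp: g_def\<close>)
  have "integral {?l+1..?r+1} (\<lambda>s. W s * f (x (s - 1))) =
      integral {?l..?r} (\<lambda>s. W (1 + s) * f (x s))"
    using integral_shift_Icc_real[of ?l ?r "\<lambda>s. W s * f (x (s - 1))" 1] by (simp add: o_def)
  also have "\<dots> = integral {?l..?r} (\<lambda>s. - a1 * exp \<mu> * (exp (\<mu> * s) * g (\<beta> - (\<beta> + h) * exp (- \<mu> * s))))"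
  proof (rule integral_cong)
    fix s assume s: "s \<in> {?l..?r}"
    then have "a (1 + s) = a1" using times pos by (intro a_first) auto
    moreover have "f (x s) = - g (\<beta> - (\<beta> + h) * exp (- \<mu> * s))"
      using x1[of s] s by (simp add: g_def)
    ultimately show "W (1 + s) * f (x s) = - a1 * exp \<mu> * (exp (\<mu> * s) * g (\<beta> - (\<beta> + h) * exp (- \<mu> * s)))"
      by (simp add: W_def distrib_left exp_add)
  qed
  also have "\<dots> = - a1 * exp \<mu> * ((2 * (\<beta> + h) / \<beta> - exp (\<mu> * ?l) - exp (\<mu> * ?r)) / \<mu>)"
    by (simp only: integral_mult_right cross defect mult_zero_right add_0_right)
  finally have I: "integral {?l+1..?r+1} (\<lambda>s. W s * f (x (s - 1)))
      = - a1 * exp \<mu> * ((2 * (\<beta> + h) / \<beta> - exp (\<mu> * ?l) - exp (\<mu> * ?r)) / \<mu>)" .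
  have "exp (\<mu> * (\<tau> + 1 + \<epsilon>1)) * x (\<tau> + 1 + \<epsilon>1) =
      h - B (?l + 1) + integral {?l+1..?r+1} (\<lambda>s. W s * f (x (s - 1)))"
    using w_step[of "?l + 1" "?r + 1"] phase1[of "?l + 1"] times pos by (simp add: algebra_simps)
  also have "\<dots> = A h + B (?r + 1)"
  proof -
    have E: "E (s + 1) = (exp \<mu> * exp (\<mu> * s) - 1) / \<mu>" for s
      by (simp add: E_def distrib_left exp_add)
    have B: "B (?l + 1) = a1 * E (?l + 1)" "B (?r + 1) = a1 * E (?r + 1)"
      using times pos by (simp_all add: B_first)
    then show ?thesis
      using pos unfolding I B E A_def by (simp add: field_simps)
  qed
  finally show ?thesis by (simp add: algebra_simps)
qed

text \<open>The interval is the one of \<open>x_low\<close> delayed by one unit, so the feedback is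
  1 throughout.\<close>

lemma phase3:
  assumes "\<tau> + 1 + \<epsilon>1 \<le> t" "t \<le> \<sigma> - \<epsilon>2 + 1"
  shows "exp (\<mu> * t) * x t = A h + B t"
proof -
  have "integral {\<tau> + 1 + \<epsilon>1..t} (\<lambda>s. W s * f (x (s - 1))) = 1 * (B t - B (\<tau> + 1 + \<epsilon>1))"
  proof (rule integral_feedback_const)
    fix s assume "\<tau> + 1 + \<epsilon>1 \<le> s" "s \<le> t"
    then have "x (s - 1) < -\<delta>" using x_low[of "s - 1"] assms by simp
    then show "f (x (s - 1)) = 1" using f_low by simp
  qed (use assms times pos in auto)
  then show ?thesis
    using w_step[of "\<tau> + 1 + \<epsilon>1" t] phase2 assms times pos by simp
qed

lemma phase4:
  assumes "\<sigma> - \<epsilon>2 \<le> t" "t \<le> T"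
  shows "x t = y3 h t"
proof -
  have "0 \<le> t" using assms times pos by simp
  then have "exp (\<mu> * t) * x t = w3 h t" using assms
  proof (induction t rule: unit_step_induct)
    case (step t)
    let ?r = "\<sigma> - \<epsilon>2 + 1"
    show ?case
    proof (cases "t \<le> ?r")
      case True
      then show ?thesis
        using phase3[of t] w3_early[OF h, of t] step times pos by simp
    next
      case False
      have "integral {?r..t} (\<lambda>s. W s * f (x (s - 1))) = integral {?r..t} (\<lambda>s. W s * f (y2 h (s - 1)))"
      proof (rule integral_cong)
        fix s assume s: "s \<in> {?r..t}"
        have "f (x (s - 1)) = f (y2 h (s - 1))"
        \<comment> \<open>\<open>\<sigma> + \<epsilon>2 \<le> p1\<close> and
          \<open>p1 + \<rho> \<le> \<sigma> + 1 - \<epsilon>2\<close> make the explicit phase cover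
          the whole second crossing. Beyond it \<open>x\<close> and \<open>y2\<close> may differ,
          but the feedback is -1 for both.\<close>
        proof (cases "s - 1 \<le> \<sigma> + \<epsilon>2")
          case True
          then have "exp (\<mu> * (s - 1)) * x (s - 1) = exp (\<mu> * (s - 1)) * y2 h (s - 1)"
            using phase3[of "s - 1"] s times pos by (simp add: exp_y2)
          then show ?thesis by simp
        next
          case False
          have "exp (\<mu> * (s - 1)) * x (s - 1) = w3 h (s - 1)"
            using step(2)[of "s - 1"] False s step times pos by simp
          then have "\<delta> < x (s - 1)"
            using w3_lower[OF h, of "s - 1"] above_band[of "s - 1" "x (s - 1)"] False s step by simp
          then show ?thesis
            using y2_high[OF h, of "s - 1"] False s step f_high by simp
        qed
        then show "W s * f (x (s - 1)) = W s * f (y2 h (s - 1))" by simp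
      qed
      then show ?thesis
        using w_step[of ?r t] w3_split[of ?r t h] phase3[of ?r] w3_early[OF h, of ?r] False times pos
        by simp
    qed
  qed
  then show ?thesis by (simp add: y3_def exp_minus field_simps)
qed

lemma x_high2:
  assumes "\<sigma> + \<epsilon>2 \<le> t" "t \<le> T"
  shows "\<delta> < x t"
  using w3_lower[OF h assms] above_band[of t "x t"] phase4[of t] exp_y3[of t h] assms times pos
  by simp

end

end

text \<open>The left side is the value at the end of the period for the discontinuous equation,
  computed from the weighted level \<open>A\<close> between the crossings. Every exponential is a
  monomial in \<open>Q\<close>, \<open>X\<close> and \<open>P\<close>, up to the relation
  \<open>QT\<close>, which reduces the claim to rational algebra.\<close>

lemma Fmap_return:
  assumes "\<mu> \<noteq> 0" "a1 \<noteq> 0" and A: "A = h * (1 - 2 * exp \<mu>) - 2 * a1 * (exp \<mu> - 1) / \<mu>"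
  shows "exp (- \<mu> * (p1 + p2)) * (A + (a1 - a2) * ((exp (\<mu> * p1) - 1) / \<mu>)
      - a2 * ((exp (\<mu> * (p1 + p2)) - 1) / \<mu>) - 2 * a2 / \<mu>
      + a2 * exp \<mu> * (2 * (a1 / \<mu> - A) / (a1 / \<mu>)) / \<mu>) = Fmap \<mu> a1 a2 p1 p2 h"
    (is "?L = _")
proof -
  let ?T = "p1 + p2"
  define Q where "Q = exp (- \<mu> * ?T)"
  define X where "X = exp \<mu>"
  define P where "P = exp (\<mu> * p1)"
  have X0: "X \<noteq> 0" by (simp add: X_def)
  have QT: "Q * exp (\<mu> * ?T) = 1" by (simp add: Q_def exp_minus)
  have QP: "exp (- \<mu> * p2) = Q * P"
    unfolding Q_def P_def exp_add[symmetric] by (simp add: algebra_simps)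
  have QX: "exp (- \<mu> * (?T - 2)) = Q * X\<^sup>2"
    unfolding Q_def X_def exp_double[symmetric] exp_add[symmetric] by (simp add: algebra_simps)
  have X1: "exp (- \<mu>) = 1 / X" by (simp add: X_def exp_minus inverse_eq_divide)
  have "?L = Q * (A + (a1 - a2) * ((P - 1) / \<mu>) - a2 / \<mu>
      + a2 * X * (2 * (a1 / \<mu> - A) / (a1 / \<mu>)) / \<mu>) - (Q * exp (\<mu> * ?T)) * a2 / \<mu>"
    unfolding Q_def[symmetric] P_def[symmetric] X_def[symmetric]
    using assms(1) by (simp add: field_simps)
  also have "\<dots> = Fmap \<mu> a1 a2 p1 p2 h"
    unfolding QT Fmap_def slope_def offset_def QP QX X1 A X_def[symmetric]
    using assms(1,2) X0 by (simp add: field_simps power2_eq_square)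
  finally show ?thesis .
qed

section \<open>The return value and the curve of terminal states\<close>

context smoothed_equation
begin

text \<open>The defect of the second crossing carried to time \<open>T\<close>:
  \<open>exp \<mu>\<close> comes from the delay, \<open>exp (- \<mu> * T)\<close> from removing the
  weight, and \<open>a2\<close> is the coefficient in force one unit after that crossing.\<close>

definition q :: real
  where "q = a2 * exp (\<mu> - \<mu> * T) / \<mu> * feedback_defect \<beta> \<delta> f"

text \<open>The feedback is 1 before and -1 after the window of the delayed crossing; inside,
  \<open>crossing_integral\<close> applies with amplitude \<open>C = \<beta> - A h\<close>. The
  asymptote is \<open>a1 / \<mu>\<close>, since \<open>y2\<close> moves under \<open>a1\<close>
  there, while the weight already carries \<open>a2\<close>.\<close>

lemma y3_final:
  assumes h: "crossing h"
  shows "y3 h T = Fmap \<mu> a1 a2 p1 p2 h + q * (\<beta> - A h)"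
proof -
  let ?l = "\<sigma> - \<epsilon>2" and ?r = "\<sigma> + \<epsilon>2"
  define C where "C = \<beta> - A h"
  define D where "D = feedback_defect \<beta> \<delta> f"
  have y: "y2 h s = \<beta> - C * exp (- \<mu> * s)" if "?l \<le> s" "s \<le> ?r" for s
  proof -
    have B: "B s = a1 * E s" using that times pos by (intro B_first) auto
    show ?thesis
      unfolding y2_def B C_def E_def using pos by (simp add: exp_minus field_simps)
  qed
  have cross: "integral {?l..?r} (\<lambda>s. exp (\<mu> * s) * f (\<beta> - C * exp (- \<mu> * s)))
    = (2 * C / \<beta> - exp (\<mu> * ?l) - exp (\<mu> * ?r) + C * D) / \<mu>"
    unfolding D_def
  proof (rule crossing_integral)
    have "0 < a1 * E ?l" using E_pos[of ?l] times pos by simp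
    moreover have "0 < \<delta> * exp (\<mu> * T)" "0 < \<beta>" using pos by simp_all
    ultimately show "0 < C" using h by (simp add: crossing_def C_def)
    show "\<beta> - C * exp (- \<mu> * ?l) \<le> - \<delta>"
      using y2_low[OF h, of ?l] y[of ?l] times pos by simp
    show "\<delta> \<le> \<beta> - C * exp (- \<mu> * ?r)"
      using y2_high[OF h, of ?r] y[of ?r] times pos by simp
  qed (use pos small f_low f_high continuous_feedback in auto)
  have "integral {?l+1..?r+1} (\<lambda>s. W s * f (y2 h (s - 1))) =
      integral {?l..?r} (\<lambda>s. W (1 + s) * f (y2 h s))"
    using integral_shift_Icc_real[of ?l ?r "\<lambda>s. W s * f (y2 h (s - 1))" 1] by (simp add: o_def)
  also have "\<dots> = integral {?l..?r} (\<lambda>s. a2 * exp \<mu> * (exp (\<mu> * s) * f (\<beta> - C * exp (- \<mu> * s))))"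
  proof (rule integral_cong)
    fix s assume s: "s \<in> {?l..?r}"
    then have "a (1 + s) = a2" using times pos by (intro a_second) auto
    then show "W (1 + s) * f (y2 h s) = a2 * exp \<mu> * (exp (\<mu> * s) * f (\<beta> - C * exp (- \<mu> * s)))"
      using y[of s] s by (simp add: W_def distrib_left exp_add)
  qed
  also have "\<dots> = a2 * exp \<mu> * ((2 * C / \<beta> - exp (\<mu> * ?l) - exp (\<mu> * ?r) + C * D) / \<mu>)"
    by (simp only: integral_mult_right cross)
  finally have mid: "integral {?l+1..?r+1} (\<lambda>s. W s * f (y2 h (s - 1)))
      = a2 * exp \<mu> * ((2 * C / \<beta> - exp (\<mu> * ?l) - exp (\<mu> * ?r) + C * D) / \<mu>)" .
  have last: "integral {?r+1..T} (\<lambda>s. W s * f (y2 h (s - 1))) = -1 * (B T - B (?r + 1))"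
  proof (rule integral_feedback_const)
    fix s assume "?r + 1 \<le> s" "s \<le> T"
    then have "\<delta> < y2 h (s - 1)" using y2_high[OF h, of "s - 1"] by simp
    then show "f (y2 h (s - 1)) = -1" using f_high by simp
  qed (use times pos in auto)
  have E: "E (s + 1) = (exp \<mu> * exp (\<mu> * s) - 1) / \<mu>" for s
    by (simp add: E_def distrib_left exp_add)
  have Bs: "B (?l + 1) = a1 * E p1 + a2 * (E (?l + 1) - E p1)"
    "B (?r + 1) = a1 * E p1 + a2 * (E (?r + 1) - E p1)" "B T = a1 * E p1 + a2 * (E T - E p1)"
    using times pos by (intro B_second; simp)+
  have "w3 h T = A h + B (?l + 1) + integral {?l+1..?r+1} (\<lambda>s. W s * f (y2 h (s - 1)))
      + integral {?r+1..T} (\<lambda>s. W s * f (y2 h (s - 1)))"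
    using w3_split[of "?r + 1" T h] w3_split[of "?l + 1" "?r + 1" h] w3_early[OF h, of "?l + 1"] times pos
    by simp
  also have "\<dots> = A h + (a1 - a2) * E p1 - a2 * E T - 2 * a2 / \<mu> + a2 * exp \<mu> * (2 * C / \<beta> + C * D) / \<mu>"
    unfolding mid last Bs E using pos by (simp add: field_simps)
  finally have w: "w3 h T = \<dots>" .
  have "y3 h T = exp (- \<mu> * T) * w3 h T" by (simp add: y3_def)
  also have "\<dots> = exp (- \<mu> * T) * (A h + (a1 - a2) * E p1 - a2 * E T - 2 * a2 / \<mu>
      + a2 * exp \<mu> * (2 * C / \<beta>) / \<mu>) + exp (- \<mu> * T) * a2 * exp \<mu> * C * D / \<mu>"
    unfolding w by (simp add: ring_distribs add_divide_distrib)
  also have "exp (- \<mu> * T) * (A h + (a1 - a2) * E p1 - a2 * E T - 2 * a2 / \<mu>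
      + a2 * exp \<mu> * (2 * C / \<beta>) / \<mu>) = Fmap \<mu> a1 a2 p1 p2 h"
    unfolding C_def E_def by (rule Fmap_return) (use pos in \<open>simp_all add: A_def\<close>)
  also have "exp (- \<mu> * T) * a2 * exp \<mu> * C * D / \<mu> = q * (\<beta> - A h)"
    by (simp add: q_def C_def D_def exp_diff exp_minus inverse_eq_divide)
  finally show ?thesis .
qed

definition \<kappa> :: real where "\<kappa> = 1 - 2 * exp \<mu>"

definition dN :: "real \<Rightarrow> real \<Rightarrow> real"
  where "dN h s = W s * (deriv f (y2 h (s - 1)) * (exp (- \<mu> * (s - 1)) * \<kappa>))"

definition dy3 :: "real \<Rightarrow> real \<Rightarrow> real"
  where "dy3 h t = exp (- \<mu> * t) * (\<kappa> + integral {1..t} (dN h))"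

lemma A_derivative: "(A has_real_derivative \<kappa>) (at h)"
  unfolding A_def \<kappa>_def by (auto intro!: derivative_eq_intros)

lemma continuous_dN: "continuous_on (UNIV \<times> {1..}) (\<lambda>(h, s). dN h s)"
proof -
  have "continuous_on (UNIV \<times> {1..}) (\<lambda>x. B (snd x - 1))"
    by (rule continuous_on_compose2[OF continuous_B]) (auto intro!: continuous_intros)
  moreover have "continuous_on (UNIV \<times> {1..}) (\<lambda>x :: real \<times> real. A (fst x))"
    unfolding A_def by (intro continuous_intros)
  ultimately have "continuous_on (UNIV \<times> {1..}) (\<lambda>x. y2 (fst x) (snd x - 1))"
    unfolding y2_def by (intro continuous_intros)
  then have "continuous_on (UNIV \<times> {1..}) (\<lambda>x. deriv f (y2 (fst x) (snd x - 1)))"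
    by (rule continuous_on_compose2[OF C_infinity_derivative(2)[OF f_smooth, of UNIV]]) auto
  moreover have "continuous_on (UNIV \<times> {1..}) (\<lambda>x :: real \<times> real. W (snd x))"
    by (rule continuous_on_compose2[OF continuous_W[of UNIV]]) (auto intro!: continuous_intros)
  ultimately show ?thesis
    unfolding dN_def case_prod_beta by (intro continuous_intros)
qed

lemma continuous_dN_slice: "continuous_on {1..} (dN h)"
proof -
  have "continuous_on {1..} (\<lambda>s. (h, s))" by (intro continuous_intros)
  then show ?thesis
    using continuous_on_compose2[OF continuous_dN, of "{1..}" "\<lambda>s. (h, s)"]
    by (simp add: image_subset_iff)
qed

text \<open>\<open>h\<close> enters the integrand only through \<open>y2\<close>, which is affine in
  \<open>h\<close>, inside the smooth \<open>f\<close>; so the integral may be differentiated under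
  the integral sign.\<close>

lemma y3_derivative:
  assumes "1 \<le> t"
  shows "((\<lambda>h. y3 h t) has_real_derivative dy3 h t) (at h)"
proof -
  have "((\<lambda>h. integral (cbox 1 t) (\<lambda>s. W s * f (y2 h (s - 1)))) has_field_derivative integral (cbox 1 t) (dN h))
      (at h within UNIV)"
  proof (rule leibniz_rule_field_derivative)
    fix h s
    have "((\<lambda>h. y2 h (s - 1)) has_real_derivative exp (- \<mu> * (s - 1)) * \<kappa>) (at h)"
      unfolding y2_def by (auto intro!: derivative_eq_intros A_derivative)
    then have "((\<lambda>h. f (y2 h (s - 1))) has_real_derivative
        deriv f (y2 h (s - 1)) * (exp (- \<mu> * (s - 1)) * \<kappa>)) (at h)"
      by (rule DERIV_chain2[OF C_infinity_derivative(1)[OF f_smooth]])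
    then show "((\<lambda>h. W s * f (y2 h (s - 1))) has_field_derivative dN h s) (at h within UNIV)"
      unfolding dN_def by (rule DERIV_cmult)
  next
    fix h
    show "(\<lambda>s. W s * f (y2 h (s - 1))) integrable_on cbox 1 t"
      using assms by (auto intro!: integrable_continuous_real continuous_intros continuous_W
        continuous_on_subset[OF continuous_f_y2])
  next
    show "continuous_on (UNIV \<times> cbox 1 t) (\<lambda>(x, y). dN x y)"
      by (rule continuous_on_subset[OF continuous_dN]) auto
  qed auto
  then show ?thesis
    unfolding y3_def w3_def dy3_def
    by (auto intro!: derivative_eq_intros A_derivative)
qed

lemma continuous_dy3: "continuous_on {1..} (dy3 h)"
  unfolding dy3_def
  by (intro continuous_intros continuous_on_integral_atLeast continuous_dN_slice)

lemma T_large: "2 \<le> T"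
  using times pos by simp

lemma dy3_uniform:
  assumes "0 < \<epsilon>"
  shows "\<exists>d>0. \<forall>h. \<bar>h - h0\<bar> < d \<longrightarrow> (\<forall>t\<in>{T-1..T}. \<bar>dy3 h t - dy3 h0 t\<bar> \<le> \<epsilon>)"
proof -
  have "continuous_on (UNIV \<times> {1..T}) (\<lambda>(h, s). dN h s)"
    by (rule continuous_on_subset[OF continuous_dN]) auto
  then obtain d where d: "d > 0" "\<And>h t. \<bar>h - h0\<bar> < d \<Longrightarrow> t \<in> {1..T} \<Longrightarrow>
      \<bar>integral {1..t} (dN h) - integral {1..t} (dN h0)\<bar> \<le> \<epsilon>"
    using uniform_parametric_integral[of 1 T dN \<epsilon> h0] assms T_large by auto
  have "\<bar>dy3 h t - dy3 h0 t\<bar> \<le> \<epsilon>" if "\<bar>h - h0\<bar> < d" "t \<in> {T-1..T}" for h t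
  proof -
    have "\<bar>dy3 h t - dy3 h0 t\<bar> = exp (- \<mu> * t) * \<bar>integral {1..t} (dN h) - integral {1..t} (dN h0)\<bar>"
      by (simp add: dy3_def abs_mult[symmetric] right_diff_distrib[symmetric])
         (simp add: abs_mult)
    also have "\<dots> \<le> 1 * \<bar>integral {1..t} (dN h) - integral {1..t} (dN h0)\<bar>"
      using that T_large pos by (intro mult_right_mono) auto
    also have "\<dots> \<le> \<epsilon>" using d(2)[of h t] that T_large by simp
    finally show ?thesis .
  qed
  then show ?thesis using d(1) by blast
qed

text \<open>Given by the formula \<open>y3\<close> and not by solving the equation, the curve is
  defined for every real \<open>h\<close>; its points are terminal states only when \<open>h\<close>
  satisfies \<open>crossing\<close>.\<close>

definition \<Gamma> :: "real \<Rightarrow> C0" where "\<Gamma> h = segment (y3 h) T"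
definition \<Gamma>' :: "real \<Rightarrow> C0" where "\<Gamma>' h = segment (dy3 h) T"

lemma \<Gamma>_C1: "(\<Gamma> has_vector_derivative \<Gamma>' h) (at h)" "continuous_on UNIV \<Gamma>'"
proof -
  have "continuous_on {T-1..T} (y3 h)" "continuous_on {T-1..T} (dy3 h)" for h
    by (rule continuous_on_subset[OF continuous_y3] continuous_on_subset[OF continuous_dy3];
        use T_large in auto)+
  moreover have "((\<lambda>h. y3 h t) has_real_derivative dy3 h t) (at h)" if "t \<in> {T-1..T}" for h t
    using y3_derivative that T_large by auto
  ultimately show "(\<Gamma> has_vector_derivative \<Gamma>' h) (at h)" "continuous_on UNIV \<Gamma>'"
    unfolding \<Gamma>_def[abs_def] \<Gamma>'_def[abs_def] using segment_C1[of T y3 dy3] dy3_uniform by blast+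
qed

lemma \<Gamma>_apply: "apply_bcontfun (\<Gamma> h) s = y3 h (T + Rep_lag s)"
  unfolding \<Gamma>_def
  by (rule segment_apply) (rule continuous_on_subset[OF continuous_y3], use T_large in auto)

text \<open>\<open>f\<close> equals itself composed with the clamp onto
  \<open>[-\<delta>, \<delta>]\<close>, which does not increase distances, and its derivative is
  bounded on this compact interval.\<close>

lemma f_lipschitz: "\<exists>K. \<forall>u v. \<bar>f u - f v\<bar> \<le> K * \<bar>u - v\<bar>"
proof -
  have "bounded (deriv f ` {-\<delta>..\<delta>})"
    by (intro compact_imp_bounded compact_continuous_image C_infinity_derivative f_smooth) auto
  then obtain K where K: "K > 0" "\<And>u. u \<in> {-\<delta>..\<delta>} \<Longrightarrow> norm (deriv f u) \<le> K"
    by (auto simp: bounded_pos)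
  define c where "c u = max (-\<delta>) (min \<delta> u)" for u
  have fc: "f u = f (c u)" for u
    using f_high[of u] f_high[of \<delta>] f_low[of u] f_low[of "-\<delta>"] pos by (auto simp: c_def max_def min_def)
  have "\<bar>f u - f v\<bar> \<le> K * \<bar>u - v\<bar>" for u v
  proof -
    have "norm (f (c u) - f (c v)) \<le> K * norm (c u - c v)"
      by (rule field_differentiable_bound[of "{-\<delta>..\<delta>}" f "deriv f"])
         (use K(2) pos in \<open>auto simp: c_def intro: DERIV_subset[OF C_infinity_derivative(1)[OF f_smooth]]\<close>)
    also have "\<dots> \<le> K * \<bar>u - v\<bar>"
      using K(1) by (intro mult_left_mono) (auto simp: c_def)
    finally show ?thesis by (simp add: fc[symmetric])
  qed
  then show ?thesis by blast
qed

end

section \<open>From forward solutions to periodic ones\<close>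

context scalar_dde
begin

lemma solves_at:
  assumes "solves \<phi> x" "0 < t"
  shows "(x has_real_derivative (- \<mu> * x t + a t * f (x (t - 1)))) (at t)"
proof -
  have "at t within {0..} = at t"
    by (rule at_within_interior) (use assms in auto)
  then show ?thesis using assms unfolding dde_solution_def by (metis less_imp_le)
qed

lemma period_multiple:
  assumes "\<And>t. g (t + T) = (g t :: real)"
  shows "g (t + real n * T) = g t"
proof (induction n)
  case (Suc n)
  then show ?case using assms[of "t + real n * T"] by (simp add: algebra_simps)
qed simp

lemma periodic_solution_solves:
  assumes p: "periodic_solution \<mu> a f T p"
  shows "solves (segment p 0) p"
proof -
  have der: "(p has_real_derivative (- \<mu> * p t + a t * f (p (t - 1)))) (at t)" for t
    using p by (simp add: periodic_solution_def)
  then have cont: "continuous_on S p" for S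
    by (intro continuous_at_imp_continuous_on ballI) (blast intro: DERIV_isCont)
  show ?thesis
    unfolding dde_solution_def
  proof (intro conjI allI impI)
    show "(p has_real_derivative (- \<mu> * p t + a t * f (p (t - 1)))) (at t within {0..})" for t
      by (rule DERIV_subset[OF der]) simp
  qed (use segment_apply[OF cont, of 0] cont in auto)
qed

text \<open>The value at \<open>t\<close> is read off after enough periods to reach a nonnegative
  time. Any sufficient number of periods gives the same value, so near a given \<open>t\<close> a
  single one can be used.\<close>

lemma periodic_extension:
  assumes x: "solves \<phi> x" and T: "1 \<le> T" and a: "\<And>t. a (t + T) = a t"
    and per: "\<And>t. 0 \<le> t \<Longrightarrow> x (T + t) = x t"
  shows "\<exists>p. periodic_solution \<mu> a f T p \<and> (\<forall>t\<ge>0. p t = x t)"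
proof -
  have per_n: "x (t + real n * T) = x t" if "0 \<le> t" for t n
  proof (induction n)
    case (Suc n)
    then show ?case using per[of "t + real n * T"] that T by (simp add: algebra_simps)
  qed simp
  define N where "N t = nat \<lceil>- t / T\<rceil>" for t
  have N: "0 \<le> t + real (N t) * T" for t
  proof -
    have "- t / T \<le> real (N t)" unfolding N_def by linarith
    then show ?thesis using T by (simp add: field_simps)
  qed
  define p where "p t = x (t + real (N t) * T)" for t
  have p: "p t = x (t + real n * T)" if "0 \<le> t + real n * T" for t n
  proof (cases "n \<le> N t")
    case True
    then have "t + real (N t) * T = (t + real n * T) + real (N t - n) * T"
      by (simp add: of_nat_diff algebra_simps)
    then show ?thesis unfolding p_def using per_n[OF that] by metis
  next
    case False
    then have "t + real n * T = (t + real (N t) * T) + real (n - N t) * T"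
      by (simp add: of_nat_diff algebra_simps)
    then show ?thesis unfolding p_def using per_n[OF N] by metis
  qed
  have "p (t + T) = p t" for t
  proof -
    have "t + real (Suc (N t)) * T = (t + T) + real (N t) * T" by (simp add: algebra_simps)
    moreover have "0 \<le> (t + T) + real (N t) * T" using N[of t] T by simp
    ultimately show ?thesis using p[of "t + T" "N t"] p[of t "Suc (N t)"] by metis
  qed
  moreover have "(p has_real_derivative (- \<mu> * p t + a t * f (p (t - 1)))) (at t)" for t
  proof -
    \<comment> \<open>Beyond time 1 both \<open>t\<close> and \<open>t - 1\<close> are shifted to
      positive times, and the derivative there is two-sided.\<close>
    obtain n where "(1 - t) / T < real n" using reals_Archimedean2 by blast
    then have n: "1 < t + real n * T" using T by (simp add: field_simps)
    have "((\<lambda>s. x (s + real n * T)) has_real_derivative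
        (- \<mu> * x (t + real n * T) + a (t + real n * T) * f (x (t + real n * T - 1)))) (at t)"
      using solves_at[OF x, of "t + real n * T"] n unfolding DERIV_shift by simp
    moreover have "x (t + real n * T) = p t" "x (t + real n * T - 1) = p (t - 1)"
      using p[of t n] p[of "t - 1" n] n by (simp_all add: algebra_simps)
    moreover have "a (t + real n * T) = a t"
      by (rule period_multiple[of a, OF a])
    ultimately have "((\<lambda>s. x (s + real n * T)) has_real_derivative
        (- \<mu> * p t + a t * f (p (t - 1)))) (at t)"
      by simp
    then show ?thesis
      by (rule has_field_derivative_transform_within_open[of _ _ _ "{t-1<..}"])
         (use n p[of _ n] in auto)
  qed
  moreover have "p t = x t" if "0 \<le> t" for t
    using p[of t 0] that by simp
  ultimately show ?thesis
    unfolding periodic_solution_def by blast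
qed

end

section \<open>Periodic orbit and stability\<close>

definition const_state :: "real \<Rightarrow> C0"
  where "const_state c = const_bcontfun c"

definition value0 :: "C0 \<Rightarrow> real"
  where "value0 \<phi> = apply_bcontfun \<phi> (Abs_lag 0)"

lemma const_state_apply [simp]: "apply_bcontfun (const_state c) s = c"
  by (simp add: const_state_def const_bcontfun.rep_eq)

lemma bounded_linear_value0: "bounded_linear value0"
proof (rule bounded_linear_intro[of _ 1])
  show "norm (value0 \<phi>) \<le> norm \<phi> * 1" for \<phi>
    using norm_bounded[of \<phi>] by (simp add: value0_def)
qed (simp_all add: value0_def)

lemma value0_segment:
  "continuous_on {t-1..t} x \<Longrightarrow> value0 (segment x t) = x t"
  by (simp add: value0_def segment_apply Rep_lag_zero)

text \<open>\<open>mt\<close> and \<open>ct\<close> collect the coefficient of \<open>h\<close> and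
  the constant term of \<open>Fmap \<mu> a1 a2 p1 p2 h + q * (\<beta> - A h)\<close>;
  \<open>ct / (1 - mt)\<close> is the fixed point of the resulting affine map.\<close>

locale smoothed_loop = smoothed_equation +
  fixes hs \<eta> mt ct :: real
  assumes \<eta>: "0 < \<eta>"
    and crossing: "\<And>h. \<bar>h - hs\<bar> < \<eta> \<Longrightarrow> crossing h"
    and mt_def: "mt = slope \<mu> a1 a2 p1 p2 - q * \<kappa>"
    and ct_def: "ct = offset \<mu> a1 a2 p1 p2 + q * (\<beta> + 2 * a1 * (exp \<mu> - 1) / \<mu>)"
    and mt: "mt \<noteq> 0" "mt \<noteq> 1"
    and fixed_point_near: "\<bar>ct / (1 - mt) - hs\<bar> < \<eta>"
begin

definition ht :: real where "ht = ct / (1 - mt)"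

lemma affine_fixed_point: "mt * h + ct = h \<longleftrightarrow> h = ht"
  using mt by (auto simp: ht_def field_simps)

lemma y3_affine: "\<bar>h - hs\<bar> < \<eta> \<Longrightarrow> y3 h T = mt * h + ct"
  unfolding y3_final[OF crossing] mt_def ct_def Fmap_def A_def \<kappa>_def by (simp add: algebra_simps add_divide_distrib diff_divide_distrib)

lemma high_initial: "\<bar>h - hs\<bar> < \<eta> \<Longrightarrow> \<delta> < h"
proof -
  assume "\<bar>h - hs\<bar> < \<eta>"
  then have "\<delta> * exp (\<mu> * T) < h - a1 * E (\<tau> - \<epsilon>1)"
    using crossing by (simp add: crossing_def)
  moreover have "0 < a1 * E (\<tau> - \<epsilon>1)" using E_pos times pos by simp
  moreover have "\<delta> * 1 \<le> \<delta> * exp (\<mu> * T)" using pos by (intro mult_left_mono) auto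
  ultimately show ?thesis by simp
qed

text \<open>\<open>\<sigma> + 1 + \<epsilon>2 \<le> T\<close> places the whole window
  \<open>[T - 1, T]\<close> after the second crossing. The terminal segment thus depends on the
  state through its value at 0 alone and is again above the band.\<close>

lemma solution_at_T:
  assumes "solves \<phi> x" "\<And>s. \<delta> \<le> apply_bcontfun \<phi> s" "\<bar>value0 \<phi> - hs\<bar> < \<eta>"
  shows "segment x T = \<Gamma> (value0 \<phi>)" "x T = mt * value0 \<phi> + ct"
    "\<And>s. s \<in> {-1..0} \<Longrightarrow> \<delta> < x (T + s)"
proof -
  note h = crossing[OF assms(3)] assms(1,2) value0_def[of \<phi>, symmetric]
  have cont: "continuous_on {T-1..T} x"
    by (rule continuous_on_subset[OF solves_continuous[OF assms(1)]]) (use T_large in auto)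
  show "segment x T = \<Gamma> (value0 \<phi>)"
  proof (rule bcontfun_eqI)
    fix s
    show "apply_bcontfun (segment x T) s = apply_bcontfun (\<Gamma> (value0 \<phi>)) s"
      using phase4[OF h, of "T + Rep_lag s"] Rep_lag_bounds[of s] times pos
      by (simp add: segment_apply[OF cont] \<Gamma>_apply)
  qed
  show "x T = mt * value0 \<phi> + ct"
    using phase4[OF h, of T] y3_affine[OF assms(3)] times pos by simp
  show "\<delta> < x (T + s)" if "s \<in> {-1..0}" for s
    using x_high2[OF h, of "T + s"] that times by simp
qed

lemma scalar_map_affine:
  assumes h: "\<bar>h - hs\<bar> < \<eta>"
  shows "scalar_map \<mu> a f T \<delta> h = mt * h + ct"
  unfolding scalar_map_def
proof (rule the_equality)
  show "\<exists>\<phi> :: C0. (\<forall>s. \<delta> \<le> apply_bcontfun \<phi> s) \<and> apply_bcontfun \<phi> (Abs_lag 0) = h \<and>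
      mt * h + ct = dde_sol \<mu> a f \<phi> T"
    using solution_at_T(2)[OF dde_sol_solves[of "const_state h"]] high_initial[OF h] h
    by (intro exI[of _ "const_state h"]) (auto simp: value0_def)
  show "y = mt * h + ct" if "\<exists>\<phi> :: C0. (\<forall>s. \<delta> \<le> apply_bcontfun \<phi> s) \<and>
      apply_bcontfun \<phi> (Abs_lag 0) = h \<and> y = dde_sol \<mu> a f \<phi> T" for y
    using that solution_at_T(2)[OF dde_sol_solves] h by (auto simp: value0_def)
qed

lemma scalar_map_derivative:
  assumes "\<bar>h - hs\<bar> < \<eta>"
  shows "(scalar_map \<mu> a f T \<delta> has_real_derivative mt) (at h)"
proof -
  have "((\<lambda>h. mt * h + ct) has_real_derivative mt) (at h)"
    by (auto intro!: derivative_eq_intros)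
  then show ?thesis
    by (rule has_field_derivative_transform_within_open[of _ _ _ "{hs-\<eta><..<hs+\<eta>}"])
       (use assms scalar_map_affine in auto)
qed

lemma fixed_point_iff:
  "\<bar>h - hs\<bar> < \<eta> \<and> scalar_map \<mu> a f T \<delta> h = h \<longleftrightarrow> h = ht"
  using scalar_map_affine[of h] affine_fixed_point[of h] fixed_point_near by (auto simp: ht_def)

definition orbit :: "(real \<Rightarrow> real) \<Rightarrow> bool"
  where "orbit p \<longleftrightarrow> periodic_solution \<mu> a f T p \<and> (\<forall>s\<in>{-1..0}. \<delta> \<le> p s) \<and> \<bar>p 0 - hs\<bar> < \<eta>"

text \<open>The coordinate of the curve is affine near \<open>hs\<close>; uniqueness of the
  derivative yields the value without evaluating the integral in \<open>dy3\<close>.\<close>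

lemma \<Gamma>'_value0:
  assumes "\<bar>h - hs\<bar> < \<eta>"
  shows "value0 (\<Gamma>' h) = mt"
proof -
  have "((\<lambda>h. value0 (\<Gamma> h)) has_vector_derivative value0 (\<Gamma>' h)) (at h)"
    by (rule bounded_linear.has_vector_derivative[OF bounded_linear_value0 \<Gamma>_C1(1)])
  moreover have "((\<lambda>h. value0 (\<Gamma> h)) has_real_derivative mt) (at h)"
  proof (rule has_field_derivative_transform_within_open[of "\<lambda>h. mt * h + ct" _ _ "{hs-\<eta><..<hs+\<eta>}"])
    show "((\<lambda>h. mt * h + ct) has_real_derivative mt) (at h)"
      by (auto intro!: derivative_eq_intros)
    show "mt * x + ct = value0 (\<Gamma> x)" if "x \<in> {hs-\<eta><..<hs+\<eta>}" for x
      using y3_affine[of x] that by (simp add: value0_def \<Gamma>_apply Rep_lag_zero abs_less_iff)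
  qed (use assms in auto)
  ultimately show ?thesis
    using DERIV_unique has_real_derivative_iff_has_vector_derivative by blast
qed

text \<open>A solution starting from the constant \<open>ht\<close> returns to the value
  \<open>ht\<close> with a different history, but both histories lie above the band, so the solution
  repeats from time 0 on. Its values on \<open>[-1, 0]\<close> are then replaced by those one period
  later.\<close>

lemma orbit_exists: "\<exists>p. orbit p"
proof -
  let ?\<phi> = "const_state ht"
  define x where "x = dde_sol \<mu> a f ?\<phi>"
  have near: "\<bar>ht - hs\<bar> < \<eta>" using fixed_point_near by (simp add: ht_def)
  have x: "solves ?\<phi> x" unfolding x_def by (rule dde_sol_solves)
  have init: "x s = ht" if "s \<in> {-1..0}" for s
    using solves_initial[OF x that] by simp
  have high: "\<And>s. \<delta> \<le> apply_bcontfun ?\<phi> s" using high_initial[OF near] by simp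
  have v: "value0 ?\<phi> = ht" by (simp add: value0_def)
  have xT: "x T = ht"
    using solution_at_T(2)[OF x high] near affine_fixed_point by (simp add: v)
  have highT: "\<delta> < x (T + s)" if "s \<in> {-1..0}" for s
    using solution_at_T(3)[OF x high _ that] near by (simp add: v)
  have per: "x (T + t) = x t" if "0 \<le> t" for t
  proof (rule solution_shift[OF x x])
    show "f (x (T + s)) = f (x s)" if "s \<in> {-1..0}" for s
      using highT[OF that] init[OF that] high f_high by (simp add: less_imp_le)
  qed (use that a_periodic xT init T_large in auto)
  obtain p where p: "periodic_solution \<mu> a f T p" "\<And>t. 0 \<le> t \<Longrightarrow> p t = x t"
    using periodic_extension[OF x _ a_periodic per] T_large by auto
  have "\<delta> \<le> p s" if "s \<in> {-1..0}" for s
  proof -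
    have "p s = p (T + s)" using p(1) by (simp add: periodic_solution_def add.commute)
    then show ?thesis using p(2)[of "T + s"] highT[OF that] that T_large by simp
  qed
  moreover have "p 0 = ht" using p(2)[of 0] init[of 0] by simp
  ultimately show ?thesis
    using p near by (auto simp: orbit_def)
qed

context
  fixes p
  assumes orbit: "orbit p"
begin

lemma orbit_solves: "solves (segment p 0) p"
  by (rule periodic_solution_solves[of T]) (use orbit in \<open>simp add: orbit_def\<close>)

lemma orbit_continuous: "continuous_on S p"
proof -
  have "isCont p t" for t
    using orbit unfolding orbit_def periodic_solution_def by (blast intro: DERIV_isCont)
  then show ?thesis by (simp add: continuous_at_imp_continuous_on)
qed

lemma orbit_segment: "apply_bcontfun (segment p t) s = p (t + Rep_lag s)"
  by (rule segment_apply[OF orbit_continuous])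

lemma orbit_periodic: "p (t + T) = p t"
  using orbit by (simp add: orbit_def periodic_solution_def)

lemma orbit_initial: "p 0 = ht" "value0 (segment p 0) = ht"
proof -
  have v: "value0 (segment p 0) = p 0"
    by (rule value0_segment[OF orbit_continuous])
  have "p T = mt * p 0 + ct"
    using solution_at_T(2)[OF orbit_solves] orbit Rep_lag
    by (simp add: v orbit_segment orbit_def)
  then show "p 0 = ht" using orbit_periodic[of 0] affine_fixed_point by simp
  then show "value0 (segment p 0) = ht" using v by simp
qed

lemma orbit_near: "\<bar>ht - hs\<bar> < \<eta>"
  using fixed_point_near by (simp add: ht_def)

lemma orbit_history: "\<delta> \<le> apply_bcontfun (segment p 0) s"
  using orbit Rep_lag by (simp add: orbit_segment orbit_def)

text \<open>By periodicity the initial segment equals the terminal one, which is strictly above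
  \<delta>; compactness of \<open>[-1, 0]\<close> turns this into a uniform gap.\<close>

lemma orbit_margin: "\<exists>r>0. \<forall>\<psi> s. dist \<psi> (segment p 0) < r \<longrightarrow> \<delta> \<le> apply_bcontfun \<psi> s"
proof -
  obtain s0 where s0: "s0 \<in> {-1..0}" "\<And>s. s \<in> {-1..0} \<Longrightarrow> p s0 \<le> p s"
    using continuous_attains_inf[of "{-1..0::real}" p] orbit_continuous by auto
  have "\<delta> < p (T + s0)"
    using solution_at_T(3)[OF orbit_solves orbit_history _ s0(1)] orbit_near orbit_initial by simp
  then have "0 < p s0 - \<delta>" using orbit_periodic[of s0] by (simp add: add.commute)
  moreover have "\<delta> \<le> apply_bcontfun \<psi> s" if "dist \<psi> (segment p 0) < p s0 - \<delta>" for \<psi> s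
  proof -
    have "dist (\<psi> s) (segment p 0 s) < p s0 - \<delta>"
      using dist_bounded[of \<psi> s "segment p 0"] that by simp
    moreover have "p s0 \<le> segment p 0 s"
      using s0(2)[of "Rep_lag s"] Rep_lag by (simp add: orbit_segment)
    ultimately show ?thesis by (simp add: dist_real_def abs_less_iff)
  qed
  ultimately show ?thesis by blast
qed

lemma orbit_neighborhood:
  "\<exists>U. open U \<and> segment p 0 \<in> U \<and>
    (\<forall>\<psi>\<in>U. \<bar>value0 \<psi> - hs\<bar> < \<eta> \<and> period_map \<mu> a f T \<psi> = \<Gamma> (value0 \<psi>))"
proof -
  obtain r where r: "r > 0" "\<And>\<psi> s. dist \<psi> (segment p 0) < r \<Longrightarrow> \<delta> \<le> apply_bcontfun \<psi> s"
    using orbit_margin by blast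
  define U where "U = ball (segment p 0) r \<inter> value0 -` {hs-\<eta><..<hs+\<eta>}"
  have "open U"
    unfolding U_def by (intro open_Int open_ball open_vimage open_greaterThanLessThan
        linear_continuous_on[OF bounded_linear_value0])
  moreover have "segment p 0 \<in> U"
    using r orbit_near orbit_initial by (auto simp: U_def)
  moreover have near: "\<bar>value0 \<psi> - hs\<bar> < \<eta>" if "\<psi> \<in> U" for \<psi>
    using that by (auto simp: U_def)
  moreover have "period_map \<mu> a f T \<psi> = \<Gamma> (value0 \<psi>)" if "\<psi> \<in> U" for \<psi>
    unfolding period_map_def
    by (rule solution_at_T(1)[OF dde_sol_solves r(2) near[OF that]])
       (use that in \<open>simp add: U_def dist_commute\<close>)
  ultimately show ?thesis by blast
qed

lemma orbit_fixed: "period_map \<mu> a f T (segment p 0) = segment p 0"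
proof (rule bcontfun_eqI)
  fix s
  let ?x = "dde_sol \<mu> a f (segment p 0)"
  have "continuous_on {T-1..T} ?x"
    by (rule continuous_on_subset[OF solves_continuous[OF dde_sol_solves]]) (use T_large in auto)
  then have "period_map \<mu> a f T (segment p 0) s = ?x (T + Rep_lag s)"
    unfolding period_map_def by (rule segment_apply)
  also have "\<dots> = p (T + Rep_lag s)"
    using solution_unique[OF dde_sol_solves orbit_solves] Rep_lag_bounds[of s] T_large by simp
  also have "\<dots> = segment p 0 s"
    using orbit_periodic[of "Rep_lag s"] by (simp add: orbit_segment add.commute)
  finally show "period_map \<mu> a f T (segment p 0) s = segment p 0 s" .
qed

lemma orbit_manifold:
  "\<exists>U S. open U \<and> segment p 0 \<in> U \<and> one_dim_C1_submanifold S \<and> period_map \<mu> a f T ` U \<subseteq> S"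
proof -
  obtain U where U: "open U" "segment p 0 \<in> U"
    "\<And>\<psi>. \<psi> \<in> U \<Longrightarrow> \<bar>value0 \<psi> - hs\<bar> < \<eta>"
    "\<And>\<psi>. \<psi> \<in> U \<Longrightarrow> period_map \<mu> a f T \<psi> = \<Gamma> (value0 \<psi>)"
    using orbit_neighborhood by blast
  have "one_dim_C1_submanifold (\<Gamma> ` {hs-\<eta><..<hs+\<eta>})"
  proof (rule curve_one_dim_C1_submanifold[OF bounded_linear_value0 _ _ \<Gamma>_C1 mt(1), of "const_state 1"])
    show "value0 (\<Gamma> h) = mt * h + ct" if "h \<in> {hs-\<eta><..<hs+\<eta>}" for h
      using y3_affine[of h] that by (simp add: value0_def \<Gamma>_apply Rep_lag_zero abs_less_iff)
  qed (auto simp: value0_def)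
  moreover have "period_map \<mu> a f T ` U \<subseteq> \<Gamma> ` {hs-\<eta><..<hs+\<eta>}"
    using U(3,4) by (force simp: abs_less_iff)
  ultimately show ?thesis using U(1,2) by blast
qed

lemma orbit_derivative:
  "\<exists>(M :: C0 \<Rightarrow>\<^sub>L C0) N L.
    (period_map \<mu> a f T has_derivative blinfun_apply M) (at (segment p 0)) \<and> direct_sum N L \<and>
    blinfun_apply M ` N \<subseteq> N \<and> blinfun_apply M ` L \<subseteq> L \<and>
    N = {v. blinfun_apply M v = 0} \<and> N \<noteq> {0} \<and>
    dim L = 1 \<and> (\<forall>v\<in>L. blinfun_apply M v = mt *\<^sub>R v)"
proof -
  obtain U where U: "open U" "segment p 0 \<in> U"
    "\<And>\<psi>. \<psi> \<in> U \<Longrightarrow> period_map \<mu> a f T \<psi> = \<Gamma> (value0 \<psi>)"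
    using orbit_neighborhood by blast
  \<comment> \<open>The identity on \<open>[-1, 0]\<close> vanishes at 0 but not at -1, so it is a
    nonzero element of the kernel.\<close>
  define w :: C0 where "w = segment (\<lambda>s. s) 0"
  have w: "apply_bcontfun w s = Rep_lag s" for s
    unfolding w_def by (subst segment_apply) (auto intro: continuous_intros)
  have "apply_bcontfun w (Abs_lag (-1)) = -1"
    by (simp add: w Abs_lag_inverse)
  then have "w \<noteq> 0" by auto
  moreover have "value0 w = 0" by (simp add: value0_def w Rep_lag_zero)
  moreover have "value0 (\<Gamma>' ht) = mt" by (rule \<Gamma>'_value0[OF orbit_near])
  moreover have "(\<Gamma> has_vector_derivative \<Gamma>' ht) (at (value0 (segment p 0)))"
    unfolding orbit_initial by (rule \<Gamma>_C1)
  ultimately show ?thesis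
    by (intro rank_one_derivative[where e = value0 and \<Gamma> = \<Gamma> and U = U and v = "\<Gamma>' ht" and w = w]
        bounded_linear_value0 U mt(1))
qed

text \<open>At each \<open>n * T\<close> the solution is replaced by one starting from the orbit's
  own history shifted by a constant. Both have the same future, and the shifted history is as close
  to the orbit as \<open>x (n * T)\<close> is to \<open>ht\<close>. The affine map does not increase
  this distance, so a Lipschitz bound over a single period serves all time.\<close>

lemma orbit_stable:
  assumes "\<bar>mt\<bar> < 1"
  shows "lyapunov_stable \<mu> a f p"
  unfolding lyapunov_stable_def
proof (intro allI impI)
  fix \<epsilon> :: real assume \<epsilon>: "0 < \<epsilon>"
  obtain r where r: "r > 0" "\<And>\<psi> s. dist \<psi> (segment p 0) < r \<Longrightarrow> \<delta> \<le> apply_bcontfun \<psi> s"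
    using orbit_margin by blast
  obtain K where K: "\<And>u v. \<bar>f u - f v\<bar> \<le> K * \<bar>u - v\<bar>" using f_lipschitz by blast
  obtain C where C: "C \<ge> 0" "\<And>\<phi> \<psi> x y t. solves \<phi> x \<Longrightarrow> solves \<psi> y \<Longrightarrow> t \<in> {-1..real (nat \<lceil>T\<rceil>)} \<Longrightarrow>
    \<bar>x t - y t\<bar> \<le> C * dist \<phi> \<psi>"
    using lipschitz_dependence[OF K, of "nat \<lceil>T\<rceil>"] pos by (auto simp: less_imp_le)
  \<comment> \<open>The three bounds keep shifted histories above the band, keep their values at 0
    within \<open>\<eta>\<close> of \<open>hs\<close>, and make both \<open>d\<close> and
    \<open>C * d\<close> at most \<open>\<epsilon> / 2\<close>.\<close>
  define d where "d = min (min r (\<eta> - \<bar>ht - hs\<bar>)) (\<epsilon> / (2 * (C + 1)))"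
  have d: "0 < d" "d \<le> r" "d \<le> \<eta> - \<bar>ht - hs\<bar>" "d \<le> \<epsilon> / (2 * (C + 1))"
    using r \<epsilon> C(1) orbit_near by (auto simp: d_def)
  have d': "(C + 1) * d \<le> \<epsilon> / 2"
    using d(4) C(1) by (simp add: field_simps)
  have Cd: "C * d \<le> \<epsilon> / 2" "d \<le> \<epsilon> / 2"
  proof -
    have "0 \<le> C * d" using d(1) C(1) by simp
    then show "C * d \<le> \<epsilon> / 2" "d \<le> \<epsilon> / 2"
      using d' d(1) unfolding distrib_right by linarith+
  qed
  have "dist (segment (dde_sol \<mu> a f \<phi>) t) (segment p t) < \<epsilon>"
    if \<phi>: "dist \<phi> (segment p 0) < d" and t: "0 \<le> t" for \<phi> t
  proof -
    define x where "x = dde_sol \<mu> a f \<phi>"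
    have x: "solves \<phi> x" unfolding x_def by (rule dde_sol_solves)
    \<comment> \<open>The history of \<open>x\<close> is only required to lie above the band; its
      distance to the orbit plays no part in the invariant.\<close>
    let ?good = "\<lambda>n. \<bar>x (real n * T) - ht\<bar> < d \<and> (\<forall>s\<in>{-1..0}. \<delta> \<le> x (real n * T + s))"
    have step: "?good (Suc n) \<and> (\<forall>t\<in>{0..T}. \<bar>x (real n * T + t) - p t\<bar> \<le> C * d)" if n: "?good n" for n
    proof -
      let ?h = "x (real n * T)"
      define \<psi> where "\<psi> = segment p 0 + const_state (?h - ht)"
      define y where "y = dde_sol \<mu> a f \<psi>"
      have y: "solves \<psi> y" unfolding y_def by (rule dde_sol_solves)
      have v: "value0 \<psi> = ?h"
        using orbit_initial(2) by (simp add: \<psi>_def value0_def)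
      have dist: "dist \<psi> (segment p 0) < d"
      proof -
        have "dist \<psi> (segment p 0) \<le> \<bar>?h - ht\<bar>"
          by (rule dist_bound) (simp add: \<psi>_def dist_real_def)
        then show ?thesis using n by simp
      qed
      have high: "\<delta> \<le> apply_bcontfun \<psi> s" for s
        using r(2) dist d(2) by simp
      have near: "\<bar>value0 \<psi> - hs\<bar> < \<eta>"
        using n d(3) unfolding v by linarith
      have shift: "x (real n * T + t) = y t" if "0 \<le> t" for t
      proof (rule solution_shift[OF x y])
        show "a (t + real n * T) = a t" for t
          by (rule period_multiple[of a, OF a_periodic])
        show "f (x (real n * T + s)) = f (y s)" if "s \<in> {-1..0}" for s
          using n that high solves_initial[OF y that] f_high by simp
        show "x (real n * T) = y 0"
          using solves_initial[OF y, of 0] v by (simp add: value0_def)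
      qed (use that T_large in auto)
      have next_time: "real (Suc n) * T + s = real n * T + (T + s)" for s
        by (simp add: algebra_simps)
      have "x (real (Suc n) * T) = mt * ?h + ct"
        using shift[of T] solution_at_T(2)[OF y high near] next_time[of 0] v T_large by simp
      then have "x (real (Suc n) * T) - ht = mt * (?h - ht)"
        using affine_fixed_point[of ht] by (simp add: algebra_simps)
      then have "\<bar>x (real (Suc n) * T) - ht\<bar> \<le> \<bar>?h - ht\<bar>"
        using assms by (simp add: abs_mult mult_left_le_one_le)
      moreover have "\<delta> \<le> x (real (Suc n) * T + s)" if "s \<in> {-1..0}" for s
        using solution_at_T(3)[OF y high near that] shift[of "T + s"] that T_large
        unfolding next_time by simp
      moreover have "\<bar>x (real n * T + t) - p t\<bar> \<le> C * d" if "t \<in> {0..T}" for t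
      proof -
        have "\<bar>y t - p t\<bar> \<le> C * dist \<psi> (segment p 0)"
          by (rule C(2)[OF y orbit_solves]) (use that real_nat_ceiling_ge[of T] in \<open>auto intro: order_trans\<close>)
        also have "\<dots> \<le> C * d"
          using dist C(1) by (intro mult_left_mono) auto
        finally show ?thesis using shift[of t] that by simp
      qed
      ultimately show ?thesis using n by auto
    qed
    have good: "?good n" for n
    proof (induction n)
      case 0
      have "\<bar>apply_bcontfun \<phi> (Abs_lag 0) - ht\<bar> \<le> dist \<phi> (segment p 0)"
        using dist_bounded[of \<phi> "Abs_lag 0" "segment p 0"] orbit_initial(2)
        by (simp add: value0_def dist_real_def)
      then show ?case
        using \<phi> solves_initial[OF x] r(2)[of \<phi>] d(2) by simp
    next
      case (Suc n)
      then show ?case using step by blast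
    qed
    have close: "\<bar>x s - p s\<bar> \<le> \<epsilon> / 2" if "-1 \<le> s" for s
    proof (cases "s \<le> 0")
      case True
      then have "\<bar>x s - p s\<bar> \<le> dist \<phi> (segment p 0)"
        using dist_bounded[of \<phi> "Abs_lag s" "segment p 0"] solves_initial[OF x, of s] that
        by (simp add: orbit_segment Abs_lag_inverse dist_real_def)
      then show ?thesis using \<phi> Cd by simp
    next
      case False
      define n where "n = nat \<lfloor>s / T\<rfloor>"
      have "real n \<le> s / T" "s / T \<le> real n + 1"
        using False T_large by (auto simp: n_def)
      then have "s - real n * T \<in> {0..T}"
        using T_large by (simp add: field_simps)
      then have "\<bar>x (real n * T + (s - real n * T)) - p (s - real n * T)\<bar> \<le> C * d"
        using step[OF good] by blast
      moreover have "p (s - real n * T) = p s"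
        using period_multiple[of p, OF orbit_periodic, of "s - real n * T" n] by simp
      ultimately show ?thesis using Cd by simp
    qed
    have "dist (segment x t) (segment p t) \<le> \<epsilon> / 2"
    proof (rule segment_dist_le)
      show "continuous_on {t-1..t} x"
        by (rule continuous_on_subset[OF solves_continuous[OF x]]) (use t in auto)
    qed (use orbit_continuous close t in auto)
    then show ?thesis using \<epsilon> by (simp add: x_def)
  qed
  then show "\<exists>d>0. \<forall>\<phi>. dist \<phi> (segment p 0) < d \<longrightarrow>
      (\<forall>t\<ge>0. dist (segment (dde_sol \<mu> a f \<phi>) t) (segment p t) < \<epsilon>)"
    using d(1) by blast
qed

end

text \<open>Both orbits have value \<open>ht\<close> at 0 and feedback -1 from their histories, so
  they agree at nonnegative times; periodicity carries this back to every \<open>t\<close>.\<close>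

lemma orbit_unique:
  assumes "orbit p" "orbit p'"
  shows "p = p'"
proof
  fix t
  obtain n where n: "- t / T < real n" using reals_Archimedean2 by blast
  then have pos: "0 \<le> t + real n * T" using T_large by (simp add: field_simps)
  have "p (0 + (t + real n * T)) = p' (t + real n * T)"
  proof (rule solution_shift[OF orbit_solves[OF assms(1)] orbit_solves[OF assms(2)] _ _ _ _ pos])
    show "f (p (0 + s)) = f (p' s)" if "s \<in> {-1..0}" for s
      using assms that f_high by (simp add: orbit_def)
  qed (use orbit_initial(1)[OF assms(1)] orbit_initial(1)[OF assms(2)] in auto)
  then show "p t = p' t"
    using period_multiple[of p, OF orbit_periodic[OF assms(1)]] period_multiple[of p', OF orbit_periodic[OF assms(2)]]
    by simp
qed

lemma orbit_summary:
  "(\<exists>!h. \<bar>h - hs\<bar> < \<eta> \<and> scalar_map \<mu> a f T \<delta> h = h) \<and>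
    (\<exists>!p. periodic_solution \<mu> a f T p \<and> (\<forall>s\<in>{-1..0}. \<delta> \<le> p s) \<and> \<bar>p 0 - hs\<bar> < \<eta>) \<and>
    (\<forall>h p. (\<bar>h - hs\<bar> < \<eta> \<and> scalar_map \<mu> a f T \<delta> h = h) \<and>
      periodic_solution \<mu> a f T p \<and> (\<forall>s\<in>{-1..0}. \<delta> \<le> p s) \<and> \<bar>p 0 - hs\<bar> < \<eta> \<longrightarrow>
      apply_bcontfun (segment p 0) (Abs_lag 0) = h \<and>
      period_map \<mu> a f T (segment p 0) = segment p 0 \<and>
      (\<exists>U S. open U \<and> segment p 0 \<in> U \<and> one_dim_C1_submanifold S \<and> period_map \<mu> a f T ` U \<subseteq> S) \<and>
      scalar_map \<mu> a f T \<delta> differentiable (at h) \<and>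
      (\<exists>(M :: C0 \<Rightarrow>\<^sub>L C0) N L.
        (period_map \<mu> a f T has_derivative blinfun_apply M) (at (segment p 0)) \<and>
        direct_sum N L \<and>
        blinfun_apply M ` N \<subseteq> N \<and> blinfun_apply M ` L \<subseteq> L \<and>
        N = {v. blinfun_apply M v = 0} \<and> N \<noteq> {0} \<and>
        dim L = 1 \<and> (\<forall>v\<in>L. blinfun_apply M v = deriv (scalar_map \<mu> a f T \<delta>) h *\<^sub>R v)))"
  unfolding fixed_point_iff orbit_def[symmetric]
proof (intro conjI allI impI)
  show "\<exists>!p. orbit p"
    using orbit_exists orbit_unique by blast
  fix h p assume *: "h = ht \<and> orbit p"
  have near: "\<bar>ht - hs\<bar> < \<eta>" using fixed_point_near by (simp add: ht_def)
  show "apply_bcontfun (segment p 0) (Abs_lag 0) = h"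
    using * orbit_initial(2)[of p] by (simp add: value0_def)
  show "scalar_map \<mu> a f T \<delta> differentiable (at h)"
    using * scalar_map_derivative[OF near] real_differentiable_def by blast
  have "deriv (scalar_map \<mu> a f T \<delta>) h = mt"
    using * scalar_map_derivative[OF near] by (simp add: DERIV_imp_deriv)
  then show "\<exists>(M :: C0 \<Rightarrow>\<^sub>L C0) N L.
      (period_map \<mu> a f T has_derivative blinfun_apply M) (at (segment p 0)) \<and>
      direct_sum N L \<and>
      blinfun_apply M ` N \<subseteq> N \<and> blinfun_apply M ` L \<subseteq> L \<and>
      N = {v. blinfun_apply M v = 0} \<and> N \<noteq> {0} \<and>
      dim L = 1 \<and> (\<forall>v\<in>L. blinfun_apply M v = deriv (scalar_map \<mu> a f T \<delta>) h *\<^sub>R v)"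
    using * orbit_derivative[of p] by simp
qed (use orbit_fixed orbit_manifold in auto)

end

section \<open>Constants independent of the smoothing\<close>

lemma isCont_eventually_at_right_less:
  fixes g :: "real \<Rightarrow> real"
  assumes "isCont g 0" "g 0 < c"
  shows "\<forall>\<^sub>F \<epsilon> in at_right 0. g \<epsilon> < c"
  using order_tendstoD(2)[OF _ assms(2), of g "at_right 0"] assms(1)
    filterlim_at_split isCont_def by blast

lemma eventually_at_right_0_exists:
  assumes "\<forall>\<^sub>F \<epsilon> in at_right (0::real). P \<epsilon>"
  shows "\<exists>\<epsilon>>0. P \<epsilon>"
  using eventually_happens'[OF trivial_limit_at_right_real eventually_conj[OF eventually_at_right_less assms]]
  by blast

text \<open>With \<open>t1 \<mu> a1 h > 0\<close>, the inequality
  \<open>t2 \<mu> a1 h + 1 < p1 + p2\<close> says that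
  \<open>(2 - exp (- \<mu>)) * exp (- \<mu> * (p1 + p2 - 2))\<close> is below 1; the remaining
  factor of the slope exceeds \<open>- exp (- \<mu>)\<close>.\<close>

lemma slope_lower_bound:
  assumes "0 < \<mu>" "0 < a1" "0 < a2" "0 < t1 \<mu> a1 h" "t2 \<mu> a1 h + 1 < p1 + p2"
  shows "-1 < slope \<mu> a1 a2 p1 p2"
proof -
  let ?c = "2 - exp (- \<mu>)"
  have "exp (- \<mu>) < 1" using assms by simp
  then have c: "0 < ?c" by linarith
  have "\<mu> * t1 \<mu> a1 h + ln ?c = \<mu> * (t2 \<mu> a1 h + 1 - 2)"
    using assms by (simp add: t2_def field_simps)
  also have "\<dots> < \<mu> * (p1 + p2 - 2)"
    using assms by simp
  finally have "ln ?c + - \<mu> * (p1 + p2 - 2) < 0"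
    using mult_pos_pos[OF assms(1,4)] by simp
  then have "exp (ln ?c) * exp (- \<mu> * (p1 + p2 - 2)) < 1"
    unfolding exp_add[symmetric] by simp
  then have P: "?c * exp (- \<mu> * (p1 + p2 - 2)) < 1" (is "?P < 1")
    using c by simp
  have P0: "0 < ?P" using c by simp
  have "- 1 < - exp (- \<mu>) * ?P"
    using \<open>exp (- \<mu>) < 1\<close> P P0 mult_strict_mono'[of "exp (- \<mu>)" 1 ?P 1] by simp
  also have "\<dots> \<le> (2 * (a2 / a1) - exp (- \<mu>)) * ?P"
    using P0 assms by (intro mult_right_mono) auto
  finally show ?thesis by (simp add: slope_def mult.assoc)
qed

lemma smoothed_loop_exists:
  fixes \<mu> a1 a2 p1 p2 hs :: real
  defines "\<tau> \<equiv> t1 \<mu> a1 hs" and "\<sigma> \<equiv> t2 \<mu> a1 hs" and "m \<equiv> slope \<mu> a1 a2 p1 p2" and "T \<equiv> p1 + p2"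
  assumes pos: "0 < \<mu>" "0 < a1" "0 < a2" "0 < p1" "0 < p2" and m: "m \<notin> {0, 1}"
    and hs: "0 < hs" "Fmap \<mu> a1 a2 p1 p2 hs = hs"
    and times: "0 < \<tau>" "\<tau> + 1 < \<sigma>" "\<sigma> < p1" "p1 < \<sigma> + 1" "\<sigma> + 1 < T"
  shows "\<exists>\<epsilon>1 \<epsilon>2 \<eta> \<delta>0 \<rho>0 G. 0 < \<eta> \<and> 0 < \<delta>0 \<and> 0 < \<rho>0 \<and> 0 < G \<and>
    (\<forall>\<delta> \<rho> f a. 0 < \<delta> \<and> \<delta> < \<delta>0 \<and> 0 < \<rho> \<and> \<rho> < \<rho>0 \<and>
      smoothed_feedback \<mu> a1 \<delta> f \<and> smoothed_coefficient \<mu> a1 a2 p1 p2 \<rho> a \<longrightarrow>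
      (\<exists>mt ct. smoothed_loop \<mu> a1 a2 p1 p2 \<delta> \<rho> \<tau> \<sigma> \<epsilon>1 \<epsilon>2 a f hs \<eta> mt ct \<and> \<bar>mt - m\<bar> \<le> G * \<delta>))"
proof -
  define E where "E t = (exp (\<mu> * t) - 1) / \<mu>" for t
  define \<beta> where "\<beta> = a1 / \<mu>"
  define \<kappa> where "\<kappa> = 1 - 2 * exp \<mu>"
  define A where "A h = h * (1 - 2 * exp \<mu>) - 2 * a1 * (exp \<mu> - 1) / \<mu>" for h
  have E_less: "E s < E t" if "s < t" for s t
    using that pos by (simp add: E_def divide_strict_right_mono)
  have E_cont: "isCont (\<lambda>\<epsilon>. E (g \<epsilon>)) x" if "isCont g x" for g x
    using that pos unfolding E_def by (intro continuous_intros) auto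
  have E_Suc: "E (s + 1) = (exp \<mu> * exp (\<mu> * s) - 1) / \<mu>" for s
    by (simp add: E_def distrib_left exp_add)
  have exp_less: "exp (- \<mu>) < 1" using pos by simp
  have exp\<tau>: "exp (\<mu> * \<tau>) = (\<mu> * hs + a1) / a1"
    using pos hs(1) by (simp add: \<tau>_def t1_def add_pos_pos)
  have "\<mu> * \<sigma> = \<mu> * \<tau> + \<mu> + ln (2 - exp (- \<mu>))"
    using pos by (simp add: \<sigma>_def t2_def \<tau>_def[symmetric] field_simps)
  moreover have "0 < 2 - exp (- \<mu>)" using exp_less by linarith
  ultimately have "exp (\<mu> * \<sigma>) = exp (\<mu> * \<tau>) * exp \<mu> * (2 - exp (- \<mu>))"
    by (simp add: exp_add)
  then have exp\<sigma>: "exp (\<mu> * \<sigma>) = exp (\<mu> * \<tau>) * (2 * exp \<mu> - 1)"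
    by (simp add: right_diff_distrib exp_minus mult.assoc)
  \<comment> \<open>This identity and the next two say that, for the discontinuous equation at
    \<open>hs\<close>, the first phase vanishes at \<tau> and the rising phase at \<sigma>.\<close>
  have hs\<tau>: "hs = a1 * E \<tau>"
    using pos by (simp add: E_def exp\<tau> field_simps)
  have hs\<sigma>: "hs - 2 * a1 * E (\<tau> + 1) + a1 * E \<sigma> = 0"
    using pos unfolding E_Suc by (simp add: E_def exp\<sigma> exp\<tau> field_simps)
  have A\<sigma>: "A hs = - a1 * E \<sigma>"
    using pos by (simp add: A_def E_def exp\<sigma> exp\<tau> field_simps)
  \<comment> \<open>The fixed point equation times \<open>exp (\<mu> * T)\<close>. The right side is
    the last expression in \<open>crossing\<close> with \<open>\<epsilon>2\<close> set to 0, so its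
    margin is \<open>hs * exp (\<mu> * T) > 0\<close>.\<close>
  have hsT: "hs * exp (\<mu> * T) = A hs + 2 * (a1 * E p1 + a2 * (E (\<sigma> + 1) - E p1))
      - (a1 * E p1 + a2 * (E T - E p1))"
  proof -
    have "2 * (\<beta> - A hs) / \<beta> = 2 * exp (\<mu> * \<sigma>)"
      unfolding A\<sigma> \<beta>_def E_def using pos by (simp add: field_simps)
    then have "exp (- \<mu> * T) * (A hs + (a1 - a2) * E p1 - a2 * E T - 2 * a2 / \<mu>
        + a2 * exp \<mu> * (2 * exp (\<mu> * \<sigma>)) / \<mu>) = hs"
      using Fmap_return[of \<mu> a1 "A hs" hs p1 p2 a2] pos
      by (simp add: hs(2) A_def[symmetric] E_def[symmetric] T_def[symmetric] \<beta>_def[symmetric])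
    then have "hs * exp (\<mu> * T) = A hs + (a1 - a2) * E p1 - a2 * E T - 2 * a2 / \<mu>
        + a2 * exp \<mu> * (2 * exp (\<mu> * \<sigma>)) / \<mu>"
      by (simp add: exp_minus field_simps)
    then show ?thesis
      unfolding E_Suc using pos by (simp add: field_simps)
  qed

  have "\<forall>\<^sub>F \<epsilon> in at_right 0. \<sigma> + \<epsilon> < p1 \<and> \<epsilon> - (\<sigma> + 1) < - p1 \<and> \<sigma> + 1 + \<epsilon> < T \<and> \<epsilon> - \<sigma> < - (\<tau> + 1)
      \<and> 2 * a2 * (E (\<sigma> + 1) - E (\<sigma> + 1 - \<epsilon>)) < hs * exp (\<mu> * T)"
    using times pos hs(1)
    by (intro eventually_conj isCont_eventually_at_right_less) (auto intro!: continuous_intros E_cont)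
  \<comment> \<open>All conditions are strict at 0 and continuous, hence persist; strictness in the
    second one leaves room for \<rho> after \<open>p1\<close>.\<close>
  then obtain \<epsilon>2 where \<epsilon>2: "0 < \<epsilon>2" "\<sigma> + \<epsilon>2 < p1" "\<epsilon>2 - (\<sigma> + 1) < - p1" "\<sigma> + 1 + \<epsilon>2 < T"
    "\<epsilon>2 - \<sigma> < - (\<tau> + 1)" "2 * a2 * (E (\<sigma> + 1) - E (\<sigma> + 1 - \<epsilon>2)) < hs * exp (\<mu> * T)"
    using eventually_at_right_0_exists by blast
  have "\<forall>\<^sub>F \<epsilon> in at_right 0. 2 * \<epsilon> < 1 \<and> \<epsilon> < \<tau> \<and> \<tau> + 1 + \<epsilon> < \<sigma> - \<epsilon>2
      \<and> 2 * a1 * (E (\<tau> + 1) - E (\<tau> + 1 - \<epsilon>)) < a1 * (E \<sigma> - E (\<sigma> - \<epsilon>2))"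
    using times pos \<epsilon>2 E_less[of "\<sigma> - \<epsilon>2" \<sigma>]
    by (intro eventually_conj isCont_eventually_at_right_less) (auto intro!: continuous_intros E_cont)
  \<comment> \<open>\<open>\<epsilon>1\<close> comes second: what the first crossing may regain has
    to stay below the margin that \<open>\<epsilon>2\<close> creates before \<sigma>.\<close>
  then obtain \<epsilon>1 where \<epsilon>1: "0 < \<epsilon>1" "2 * \<epsilon>1 < 1" "\<epsilon>1 < \<tau>" "\<tau> + 1 + \<epsilon>1 < \<sigma> - \<epsilon>2"
    "2 * a1 * (E (\<tau> + 1) - E (\<tau> + 1 - \<epsilon>1)) < a1 * (E \<sigma> - E (\<sigma> - \<epsilon>2))"
    using eventually_at_right_0_exists by blast

  \<comment> \<open>The margins of the six conditions in \<open>crossing\<close> at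
    \<open>hs\<close>, with the \<delta> terms removed.\<close>
  define S where "S = {a1 * (E \<tau> - E (\<tau> - \<epsilon>1)), a1 * (E (\<tau> + \<epsilon>1) - E \<tau>),
    a1 * (E \<sigma> - E (\<sigma> - \<epsilon>2)) - 2 * a1 * (E (\<tau> + 1) - E (\<tau> + 1 - \<epsilon>1)),
    a1 * (E \<sigma> - E (\<sigma> - \<epsilon>2)), a1 * (E (\<sigma> + \<epsilon>2) - E \<sigma>),
    hs * exp (\<mu> * T) - 2 * a2 * (E (\<sigma> + 1) - E (\<sigma> + 1 - \<epsilon>2))}"
  define R where "R = Min S"
  have "\<forall>x\<in>S. 0 < x"
    unfolding S_def using pos \<epsilon>1 \<epsilon>2 E_less[of "\<tau> - \<epsilon>1" \<tau>] E_less[of \<tau> "\<tau> + \<epsilon>1"]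
      E_less[of "\<sigma> - \<epsilon>2" \<sigma>] E_less[of \<sigma> "\<sigma> + \<epsilon>2"] by simp
  moreover have S: "finite S" "S \<noteq> {}" by (simp_all add: S_def)
  ultimately have R0: "0 < R" unfolding R_def by simp
  have R: "R \<le> a1 * (E \<tau> - E (\<tau> - \<epsilon>1))" "R \<le> a1 * (E (\<tau> + \<epsilon>1) - E \<tau>)"
    "R \<le> a1 * (E \<sigma> - E (\<sigma> - \<epsilon>2)) - 2 * a1 * (E (\<tau> + 1) - E (\<tau> + 1 - \<epsilon>1))"
    "R \<le> a1 * (E \<sigma> - E (\<sigma> - \<epsilon>2))" "R \<le> a1 * (E (\<sigma> + \<epsilon>2) - E \<sigma>)"
    "R \<le> hs * exp (\<mu> * T) - 2 * a2 * (E (\<sigma> + 1) - E (\<sigma> + 1 - \<epsilon>2))"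
    unfolding R_def by (rule Min_le[OF S(1)], simp add: S_def)+

  \<comment> \<open>\<open>X\<close> bounds the slope \<kappa> of \<open>A\<close> and exceeds 1, so
    moving \<open>h\<close> by less than \<open>\<eta>\<close> changes both \<open>h\<close> and
    \<open>A h\<close> by at most \<open>R / 2\<close>.\<close>
  define X where "X = 2 * exp \<mu>"
  have X: "1 < X" "\<bar>\<kappa>\<bar> \<le> X"
  proof -
    have "1 < exp \<mu>" using pos by simp
    then show "1 < X" "\<bar>\<kappa>\<bar> \<le> X" unfolding X_def \<kappa>_def by linarith+
  qed
  define \<eta> where "\<eta> = R / (2 * X)"
  have \<eta>: "0 < \<eta>" "X * \<eta> = R / 2" "\<eta> \<le> R / 2"
    using R0 X(1) by (auto simp: \<eta>_def field_simps)
  define H where "H = a2 * exp (\<mu> - \<mu> * T) / \<mu> * (16 / \<beta>\<^sup>2)"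
  define G where "G = H * X"
  have \<beta>: "0 < \<beta>" using pos by (simp add: \<beta>_def)
  have H: "0 < H" using pos \<beta> by (simp add: H_def)
  have G: "0 < G" "H \<le> G" using H X(1) by (simp_all add: G_def)
  define \<rho>0 where "\<rho>0 = min (\<tau> - \<epsilon>1) (\<sigma> + 1 - \<epsilon>2 - p1)"
  have \<rho>0: "0 < \<rho>0" using \<epsilon>1 \<epsilon>2 by (simp add: \<rho>0_def)
  define Z where "Z = 1 + \<bar>\<beta> - A hs\<bar>"
  \<comment> \<open>In order, the bounds ensure that
    \<open>\<delta> * exp (\<mu> * T) < R / 2\<close>, that the defect estimate applies, that
    \<open>mt \<noteq> 0\<close>, that \<open>\<bar>1 - mt\<bar> > \<bar>m - 1\<bar> / 2\<close>,
    and that the fixed point moves by less than \<open>\<eta>\<close>.\<close>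
  define \<delta>0 where "\<delta>0 = Min {R / (2 * exp (\<mu> * T)), \<beta> / 2, \<bar>m\<bar> / G, \<bar>m - 1\<bar> / (2 * G), \<eta> * \<bar>m - 1\<bar> / (2 * H * Z)}"
  have \<delta>0: "0 < \<delta>0"
    using R0 \<beta> m G H \<eta> by (auto simp: \<delta>0_def Z_def intro!: divide_pos_pos mult_pos_pos)

  have "\<exists>mt ct. smoothed_loop \<mu> a1 a2 p1 p2 \<delta> \<rho> \<tau> \<sigma> \<epsilon>1 \<epsilon>2 a f hs \<eta> mt ct \<and> \<bar>mt - m\<bar> \<le> G * \<delta>"
    if adm: "0 < \<delta>" "\<delta> < \<delta>0" "0 < \<rho>" "\<rho> < \<rho>0" "smoothed_feedback \<mu> a1 \<delta> f"
      "smoothed_coefficient \<mu> a1 a2 p1 p2 \<rho> a" for \<delta> \<rho> f a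
  proof -
    have \<delta>: "\<delta> < R / (2 * exp (\<mu> * T))" "\<delta> < \<beta> / 2" "\<delta> < \<bar>m\<bar> / G" "\<delta> < \<bar>m - 1\<bar> / (2 * G)"
        "\<delta> < \<eta> * \<bar>m - 1\<bar> / (2 * H * Z)"
      using adm(2) by (simp_all add: \<delta>0_def)
    interpret eq: smoothed_equation \<mu> a1 a2 p1 p2 \<delta> \<rho> \<tau> \<sigma> \<epsilon>1 \<epsilon>2 a f
    proof
      show "\<delta> < a1 / \<mu>" using \<delta>(2) \<beta> unfolding \<beta>_def by simp
    qed (use pos adm \<epsilon>1 \<epsilon>2 in \<open>auto simp: \<rho>0_def T_def\<close>)
    have eqE: "eq.E = E" by (simp add: fun_eq_iff eq.E_def E_def)
    have eqA: "eq.A = A" by (simp add: fun_eq_iff eq.A_def A_def)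
    have \<delta>R: "\<delta> * exp (\<mu> * T) < R / 2" using \<delta>(1) by (simp add: field_simps)
    have cross: "eq.crossing h" if h: "\<bar>h - hs\<bar> < \<eta>" for h
    proof -
      have Ah: "A h - A hs = \<kappa> * (h - hs)" by (simp add: A_def \<kappa>_def algebra_simps)
      have "\<bar>\<kappa> * (h - hs)\<bar> \<le> X * \<eta>"
        unfolding abs_mult using X h by (intro mult_mono) auto
      then have A: "\<bar>A h - A hs\<bar> \<le> R / 2" using Ah \<eta> by simp
      have "eq.B (\<sigma> + 1 - \<epsilon>2) = a1 * E p1 + a2 * (E (\<sigma> + 1 - \<epsilon>2) - E p1)"
        "eq.B (p1 + p2) = a1 * E p1 + a2 * (E T - E p1)"
        using adm \<epsilon>2 eq.times eq.pos by (simp_all add: eq.B_second eqE T_def)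
      moreover have "h - hs < \<eta>" "hs - h < \<eta>" "A h - A hs \<le> R / 2" "A hs - A h \<le> R / 2"
        using h A by linarith+
      ultimately show ?thesis
        using R \<eta>(3) A\<sigma> hs\<tau> hs\<sigma> hsT \<delta>R
        unfolding eq.crossing_def eqE eqA T_def[symmetric] right_diff_distrib distrib_left
        by (intro conjI) linarith+
    qed
    have q: "\<bar>eq.q\<bar> \<le> H * \<delta>"
    proof -
      have "\<bar>feedback_defect \<beta> \<delta> f\<bar> \<le> 16 * \<delta> / \<beta>\<^sup>2"
        by (rule feedback_defect_bound)
           (use adm(1) \<delta>(2) eq.continuous_feedback eq.f_bounded in auto)
      then have "a2 * exp (\<mu> - \<mu> * T) / \<mu> * \<bar>feedback_defect \<beta> \<delta> f\<bar>
          \<le> a2 * exp (\<mu> - \<mu> * T) / \<mu> * (16 * \<delta> / \<beta>\<^sup>2)"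
        using pos by (intro mult_left_mono) auto
      then show ?thesis
        using pos by (simp add: eq.q_def H_def abs_mult \<beta>_def T_def)
    qed
    define mt where "mt = m - eq.q * \<kappa>"
    define ct where "ct = offset \<mu> a1 a2 p1 p2 + eq.q * (\<beta> + 2 * a1 * (exp \<mu> - 1) / \<mu>)"
    have mtm: "\<bar>mt - m\<bar> \<le> G * \<delta>"
    proof -
      have "\<bar>eq.q\<bar> * \<bar>\<kappa>\<bar> \<le> (H * \<delta>) * X"
        using q X adm(1) H by (intro mult_mono) auto
      then show ?thesis by (simp add: mt_def G_def abs_mult mult_ac)
    qed
    have "G * \<delta> < \<bar>m\<bar>" "G * \<delta> < \<bar>m - 1\<bar> / 2"
      using \<delta>(3,4) G by (simp_all add: field_simps)
    with mtm have mt: "mt \<noteq> 0" "\<bar>m - 1\<bar> / 2 < \<bar>1 - mt\<bar>" by (auto simp: abs_if split: if_splits)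
    then have mt1: "mt \<noteq> 1" by auto
    \<comment> \<open>\<open>Fmap\<close> fixes \<open>hs\<close>, so only the error term is left;
      divided by \<open>1 - mt\<close> it is the displacement of the fixed point.\<close>
    have "mt * hs + ct = hs + eq.q * (\<beta> - A hs)"
      using hs(2) by (simp add: Fmap_def mt_def ct_def m_def A_def \<kappa>_def algebra_simps add_divide_distrib diff_divide_distrib)
    then have "ct / (1 - mt) - hs = eq.q * (\<beta> - A hs) / (1 - mt)"
      using mt1 by (simp add: field_simps)
    also have "\<bar>\<dots>\<bar> = \<bar>eq.q\<bar> * \<bar>\<beta> - A hs\<bar> / \<bar>1 - mt\<bar>"
      by (simp add: abs_mult)
    also have "\<dots> < \<eta>"
    proof -
      have "\<bar>eq.q\<bar> * \<bar>\<beta> - A hs\<bar> \<le> H * \<delta> * Z"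
        using q H adm(1) by (intro mult_mono) (auto simp: Z_def)
      also have "\<dots> < \<eta> * (\<bar>m - 1\<bar> / 2)"
      proof -
        have "0 < 2 * H * Z" using H by (simp add: Z_def)
        then show ?thesis using \<delta>(5) by (simp add: less_divide_eq mult_ac)
      qed
      also have "\<dots> < \<eta> * \<bar>1 - mt\<bar>"
        using mt(2) \<eta>(1) by simp
      finally show ?thesis using mt1 by (simp add: divide_less_eq)
    qed
    finally have near: "\<bar>ct / (1 - mt) - hs\<bar> < \<eta>" .
    have "smoothed_loop \<mu> a1 a2 p1 p2 \<delta> \<rho> \<tau> \<sigma> \<epsilon>1 \<epsilon>2 a f hs \<eta> mt ct"
    proof (intro smoothed_loop.intro smoothed_loop_axioms.intro)
      show "mt = slope \<mu> a1 a2 p1 p2 - eq.q * eq.\<kappa>"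
        by (simp only: mt_def m_def \<kappa>_def eq.\<kappa>_def)
      show "ct = offset \<mu> a1 a2 p1 p2 + eq.q * (a1 / \<mu> + 2 * a1 * (exp \<mu> - 1) / \<mu>)"
        by (simp only: ct_def \<beta>_def)
    qed (fact eq.smoothed_equation_axioms \<eta>(1) cross mt(1) mt1 near)+
    then show ?thesis using mtm by blast
  qed
  note loop = this
  show ?thesis
  proof (rule exI[of _ \<epsilon>1], rule exI[of _ \<epsilon>2], rule exI[of _ \<eta>], rule exI[of _ \<delta>0],
      rule exI[of _ \<rho>0], rule exI[of _ G], intro conjI allI impI)
    fix \<delta> \<rho> f a
    assume "0 < \<delta> \<and> \<delta> < \<delta>0 \<and> 0 < \<rho> \<and> \<rho> < \<rho>0 \<and>
      smoothed_feedback \<mu> a1 \<delta> f \<and> smoothed_coefficient \<mu> a1 a2 p1 p2 \<rho> a"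
    then show "\<exists>mt ct. smoothed_loop \<mu> a1 a2 p1 p2 \<delta> \<rho> \<tau> \<sigma> \<epsilon>1 \<epsilon>2 a f hs \<eta> mt ct \<and> \<bar>mt - m\<bar> \<le> G * \<delta>"
      by (elim conjE) (rule loop)
  qed (fact \<eta>(1) \<delta>0 \<rho>0 G(1))+
qed

theorem theorem3p6:
  fixes \<mu> a1 a2 p1 p2 hs :: real
  assumes "\<mu> > 0" "a1 > 0" "a2 > 0" "p1 > 0" "p2 > 0"
    and "slope \<mu> a1 a2 p1 p2 \<notin> {0, 1}"
    and "hs > 0" "Fmap \<mu> a1 a2 p1 p2 hs = hs"
    and "0 < t1 \<mu> a1 hs" "t1 \<mu> a1 hs < t1 \<mu> a1 hs + 1" "t1 \<mu> a1 hs + 1 < t2 \<mu> a1 hs"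
      "t2 \<mu> a1 hs < p1" "p1 < t2 \<mu> a1 hs + 1" "t2 \<mu> a1 hs + 1 < p1 + p2"
  shows "\<exists>\<eta>>0. \<exists>\<delta>0>0. \<exists>\<rho>0>0.
    (let T = p1 + p2;
         m = slope \<mu> a1 a2 p1 p2;
         admissible = (\<lambda>\<delta> \<rho> f a. 0 < \<delta> \<and> \<delta> < \<delta>0 \<and> 0 < \<rho> \<and> \<rho> < \<rho>0 \<and>
           smoothed_feedback \<mu> a1 \<delta> f \<and> smoothed_coefficient \<mu> a1 a2 p1 p2 \<rho> a);
         fixed_point = (\<lambda>\<delta> f a h. \<bar>h - hs\<bar> < \<eta> \<and> scalar_map \<mu> a f T \<delta> h = h);
         orbit = (\<lambda>\<delta> f a p. periodic_solution \<mu> a f T p \<and>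
           (\<forall>s\<in>{-1..0}. \<delta> \<le> p s) \<and> \<bar>p 0 - hs\<bar> < \<eta>)
     in
      (\<forall>\<delta> \<rho> f a. admissible \<delta> \<rho> f a \<longrightarrow>
        (\<exists>!h. fixed_point \<delta> f a h) \<and>
        (\<exists>!p. orbit \<delta> f a p) \<and>
        (\<forall>h p. fixed_point \<delta> f a h \<and> orbit \<delta> f a p \<longrightarrow>
          (let \<phi> = segment p 0; P = period_map \<mu> a f T; lam = deriv (scalar_map \<mu> a f T \<delta>) h in
            apply_bcontfun \<phi> (Abs_lag 0) = h \<and>
            P \<phi> = \<phi> \<and>
            (\<exists>U S. open U \<and> \<phi> \<in> U \<and> one_dim_C1_submanifold S \<and> P ` U \<subseteq> S) \<and>
            scalar_map \<mu> a f T \<delta> differentiable (at h) \<and>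
            (\<exists>(M :: C0 \<Rightarrow>\<^sub>L C0) N L.
              (P has_derivative blinfun_apply M) (at \<phi>) \<and>
              direct_sum N L \<and>
              blinfun_apply M ` N \<subseteq> N \<and> blinfun_apply M ` L \<subseteq> L \<and>
              N = {v. blinfun_apply M v = 0} \<and> N \<noteq> {0} \<and>
              dim L = 1 \<and> (\<forall>v\<in>L. blinfun_apply M v = lam *\<^sub>R v))))) \<and>
      (\<forall>\<epsilon>>0. \<exists>\<delta>1>0. \<forall>\<delta> \<rho> f a h.
        \<delta> < \<delta>1 \<and> admissible \<delta> \<rho> f a \<and> fixed_point \<delta> f a h \<longrightarrow>
        \<bar>deriv (scalar_map \<mu> a f T \<delta>) h - m\<bar> < \<epsilon>) \<and>
      (m < 1 \<longrightarrow> (\<exists>\<delta>1>0. \<forall>\<delta> \<rho> f a p.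
        \<delta> < \<delta>1 \<and> admissible \<delta> \<rho> f a \<and> orbit \<delta> f a p \<longrightarrow>
        lyapunov_stable \<mu> a f p)))"
proof -
  let ?m = "slope \<mu> a1 a2 p1 p2" and ?\<tau> = "t1 \<mu> a1 hs" and ?\<sigma> = "t2 \<mu> a1 hs"
  obtain \<epsilon>1 \<epsilon>2 \<eta> \<delta>0 \<rho>0 G where pos: "0 < \<eta>" "0 < \<delta>0" "0 < \<rho>0" "0 < G" and
    loop: "\<And>\<delta> \<rho> f a. 0 < \<delta> \<and> \<delta> < \<delta>0 \<and> 0 < \<rho> \<and> \<rho> < \<rho>0 \<and>
      smoothed_feedback \<mu> a1 \<delta> f \<and> smoothed_coefficient \<mu> a1 a2 p1 p2 \<rho> a \<Longrightarrow>
      \<exists>mt ct. smoothed_loop \<mu> a1 a2 p1 p2 \<delta> \<rho> ?\<tau> ?\<sigma> \<epsilon>1 \<epsilon>2 a f hs \<eta> mt ct \<and> \<bar>mt - ?m\<bar> \<le> G * \<delta>"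
    using smoothed_loop_exists[OF assms(1-9,11-14)] by metis
  show ?thesis
    unfolding Let_def
  proof (rule exI[of _ \<eta>], intro conjI pos, rule exI[of _ \<delta>0], intro conjI pos,
      rule exI[of _ \<rho>0], intro conjI[OF pos(3)], rule conjI[OF _ conjI], goal_cases)
    case 1
    show ?case
    proof (intro allI impI, goal_cases)
      case (1 \<delta> \<rho> f a)
      obtain mt ct where "smoothed_loop \<mu> a1 a2 p1 p2 \<delta> \<rho> ?\<tau> ?\<sigma> \<epsilon>1 \<epsilon>2 a f hs \<eta> mt ct"
        using loop[OF 1] by blast
      then interpret L: smoothed_loop \<mu> a1 a2 p1 p2 \<delta> \<rho> ?\<tau> ?\<sigma> \<epsilon>1 \<epsilon>2 a f hs \<eta> mt ct .
      show ?case by (rule L.orbit_summary)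
    qed
  next
    case 2
    show ?case
    proof (intro allI impI, goal_cases)
      case (1 \<epsilon>)
      show ?case
      proof (intro exI[of _ "\<epsilon> / G"] conjI allI impI, goal_cases)
        case 1
        show ?case using \<open>0 < \<epsilon>\<close> pos by simp
      next
        case (2 \<delta> \<rho> f a h)
        obtain mt ct where L: "smoothed_loop \<mu> a1 a2 p1 p2 \<delta> \<rho> ?\<tau> ?\<sigma> \<epsilon>1 \<epsilon>2 a f hs \<eta> mt ct"
          and "\<bar>mt - ?m\<bar> \<le> G * \<delta>"
          using loop 2 by blast
        then have "\<bar>mt - ?m\<bar> < \<epsilon>" using 2 pos by (simp add: field_simps)
        moreover have "deriv (scalar_map \<mu> a f (p1 + p2) \<delta>) h = mt"
          using smoothed_loop.scalar_map_derivative[OF L] 2 by (blast intro: DERIV_imp_deriv)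
        ultimately show ?case by simp
      qed
    qed
  next
    case 3
    show ?case
    proof
      assume "?m < 1"
      moreover have "-1 < ?m" using slope_lower_bound[of \<mu> a1 a2 hs p1 p2] assms by simp
      ultimately have m: "\<bar>?m\<bar> < 1" by simp
      show "\<exists>\<delta>1>0. \<forall>\<delta> \<rho> f a p. \<delta> < \<delta>1 \<and> (0 < \<delta> \<and> \<delta> < \<delta>0 \<and> 0 < \<rho> \<and> \<rho> < \<rho>0 \<and>
          smoothed_feedback \<mu> a1 \<delta> f \<and> smoothed_coefficient \<mu> a1 a2 p1 p2 \<rho> a) \<and>
          periodic_solution \<mu> a f (p1 + p2) p \<and> (\<forall>s\<in>{-1..0}. \<delta> \<le> p s) \<and> \<bar>p 0 - hs\<bar> < \<eta> \<longrightarrow>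
          lyapunov_stable \<mu> a f p"
      \<comment> \<open>Below this threshold \<open>\<bar>mt - m\<bar> \<le> G * \<delta>\<close> is
        less than the distance of \<open>\<bar>m\<bar>\<close> from 1, so
        \<open>\<bar>mt\<bar> < 1\<close>.\<close>
      proof (intro exI[of _ "(1 - \<bar>?m\<bar>) / G"] conjI allI impI, goal_cases)
        case 1
        show ?case using m pos by simp
      next
        case (2 \<delta> \<rho> f a p)
        obtain mt ct where L: "smoothed_loop \<mu> a1 a2 p1 p2 \<delta> \<rho> ?\<tau> ?\<sigma> \<epsilon>1 \<epsilon>2 a f hs \<eta> mt ct"
          and "\<bar>mt - ?m\<bar> \<le> G * \<delta>"
          using loop 2 by blast
        moreover have "G * \<delta> < 1 - \<bar>?m\<bar>" using 2 pos by (simp add: field_simps)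
        ultimately have "\<bar>mt\<bar> < 1" by linarith
        then show ?case
          using smoothed_loop.orbit_stable[OF L] smoothed_loop.orbit_def[OF L] 2 by blast
      qed
    qed
  qed
qed

end
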